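(* Let $p$ be a prime and let $L$ be a finite-dimensional representation of $Y(\mathfrak{gl}_2)$ over $\overline{\mathbb{F}}_p$ which, as a $\mathfrak{gl}_2$-representation (via $E_{ij}\mapsto t_{ij}^{(1)}$), is isomorphic to $V(\mu^{(1)},p)\oplus\dots\oplus V(\mu^{(k)},p)$ with dominant integral weights $\mu^{(j)}=(\mu^{(j)}_1\ge\mu^{(j)}_2)$ and $p>\max_j(\mu^{(j)}_1-\mu^{(j)}_2)+1$. Suppose $L\cong L(\lambda(u),p)$ with $\lambda(u)=(\lambda_1(u),\lambda_2(u))$. Then there is a monic polynomial $P(u)\in\overline{\mathbb{F}}_p[u]$ such that $\frac{\lambda_1(u)}{\lambda_2(u)}=\frac{P(u+1)}{P(u)}$.
   Context: $Y(\mathfrak{gl}_2)$ over $\overline{\mathbb{F}}_p$ is generated by $t_{ij}^{(r)}$, $1\le i,j\le2$, $r\ge1$, with relations $[t_{ij}^{(r+1)},t_{kl}^{(s)}]-[t_{ij}^{(r)},t_{kl}^{(s+1)}]=t_{kj}^{(r)}t_{il}^{(s)}-t_{kj}^{(s)}t_{il}^{(r)}$, $t_{ij}^{(0)}=\delta_{ij}$; $t_{ij}(u)=\delta_{ij}+\sum_{r\ge1}t_{ij}^{(r)}u^{-r}$. For $\lambda_i(u)\in1+u^{-1}\overline{\mathbb{F}}_p[[u^{-1}]]$, $L(\lambda(u),p)$ is the irreducible quotient of the Verma module generated by $\xi$ with $t_{12}(u)\xi=0$, $t_{ii}(u)\xi=\lambda_i(u)\xi$. The Weyl module $V(\mu,p)$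 is the quotient of the $\mathfrak{gl}_2$-Verma module $M(\mu,p)$ with highest weight vector $v$ by the submodule generated by $f^{\mu_1-\mu_2+1}v$. *)

theory Defs
  imports "HOL-Analysis.Analysis" "HOL-Computational_Algebra.Formal_Laurent_Series"
begin

text \<open>The field: an algebraic closure of F_p, i.e. an algebraically closed field of
characteristic p in which every element is algebraic over F_p (x^(p^m) = x, m \<ge> 1).\<close>
definition is_alg_closure_Fp :: "nat \<Rightarrow> 'k::field itself \<Rightarrow> bool" where
  "is_alg_closure_Fp p _ \<longleftrightarrow>
     CHAR('k) = p \<and>
     (\<forall>P :: 'k poly. degree P \<ge> 1 \<longrightarrow> (\<exists>x. poly P x = 0)) \<and>
     (\<forall>x :: 'k. \<exists>m \<ge> 1. x ^ (p ^ m) = x)"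

definition tgen :: "(nat \<Rightarrow> nat \<Rightarrow> nat \<Rightarrow> 'k::field^'n^'n) \<Rightarrow> nat \<Rightarrow> nat \<Rightarrow> nat \<Rightarrow> 'k^'n^'n" where
  "tgen T i j r = (if r = 0 then (if i = j then mat 1 else 0) else T i j r)"

definition comm :: "'k::field^'n^'n \<Rightarrow> 'k^'n^'n \<Rightarrow> 'k^'n^'n" where
  "comm A B = A ** B - B ** A"

definition yangian_rep :: "(nat \<Rightarrow> nat \<Rightarrow> nat \<Rightarrow> 'k::field^'n^'n) \<Rightarrow> bool" where
  "yangian_rep T \<longleftrightarrow>
    (\<forall>i\<in>{1,2}. \<forall>j\<in>{1,2}. \<forall>k\<in>{1,2}. \<forall>l\<in>{1,2}. \<forall>r s.
       comm (tgen T i j (Suc r)) (tgen T k l s) - comm (tgen T i j r) (tgen T k l (Suc s))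
       = tgen T k j r ** tgen T i l s - tgen T k j s ** tgen T i l r)"

definition yinvariant :: "(nat \<Rightarrow> nat \<Rightarrow> nat \<Rightarrow> 'k::field^'n^'n) \<Rightarrow> ('k^'n) set \<Rightarrow> bool" where
  "yinvariant T S \<longleftrightarrow> (\<forall>i\<in>{1,2}. \<forall>j\<in>{1,2}. \<forall>r\<ge>1. \<forall>v\<in>S. T i j r *v v \<in> S)"

definition yirreducible :: "(nat \<Rightarrow> nat \<Rightarrow> nat \<Rightarrow> 'k::field^'n^'n) \<Rightarrow> bool" where
  "yirreducible T \<longleftrightarrow>
    (\<forall>S. vec.subspace S \<and> yinvariant T S \<longrightarrow> S = {0} \<or> S = UNIV)"

text \<open>L \<cong> L(lambda(u),p): L is irreducible and contains a nonzero vector xi with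
 t_12(u) xi = 0 and t_ii(u) xi = lambda_i(u) xi, where lambda_i(u) = 1 + sum_r lam i r u^-r.\<close>
definition iso_L_lambda :: "(nat \<Rightarrow> nat \<Rightarrow> nat \<Rightarrow> 'k::field^'n^'n) \<Rightarrow> (nat \<Rightarrow> nat \<Rightarrow> 'k) \<Rightarrow> bool" where
  "iso_L_lambda T lam \<longleftrightarrow> yirreducible T \<and>
     (\<exists>\<xi>. \<xi> \<noteq> 0 \<and> (\<forall>r\<ge>1. T 1 2 r *v \<xi> = 0) \<and>
          (\<forall>i\<in>{1,2}. \<forall>r\<ge>1. T i i r *v \<xi> = lam i r *s \<xi>))"

text \<open>Weyl module V(mu,p) for gl_2, n = mu1 - mu2: the quotient of the Verma module
 M(mu,p) (basis v_k = f^k v, k \<in> N) by the submodule spanned by f^k v, k > n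
 (which is the submodule generated by the singular vector f^(n+1) v).
 Modelled on coefficient sequences supported on {0..n}.\<close>
definition weyl_space :: "int \<Rightarrow> int \<Rightarrow> (nat \<Rightarrow> 'k::field) set" where
  "weyl_space mu1 mu2 = {c. \<forall>k. int k > mu1 - mu2 \<longrightarrow> c k = 0}"

text \<open>Action of E_ij (i,j \<in> {1,2}) on V(mu,p):
 E11 v_k = (mu1-k) v_k, E22 v_k = (mu2+k) v_k, E21 v_k = v_(k+1), E12 v_k = k(mu1-mu2-k+1) v_(k-1).\<close>
definition weyl_act :: "int \<Rightarrow> int \<Rightarrow> nat \<Rightarrow> nat \<Rightarrow> (nat \<Rightarrow> 'k::field) \<Rightarrow> (nat \<Rightarrow> 'k)" where
  "weyl_act mu1 mu2 i j c = (\<lambda>k.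
     if int k > mu1 - mu2 then 0
     else if i = 1 \<and> j = 1 then of_int (mu1 - int k) * c k
     else if i = 2 \<and> j = 2 then of_int (mu2 + int k) * c k
     else if i = 2 \<and> j = 1 then (if k = 0 then 0 else c (k - 1))
     else if i = 1 \<and> j = 2 then of_int ((int k + 1) * (mu1 - mu2 - int k)) * c (k + 1)
     else 0)"

definition gl2_iso_weyl :: "(nat \<Rightarrow> nat \<Rightarrow> nat \<Rightarrow> 'k::field^'n^'n) \<Rightarrow> ('k^'n) set \<Rightarrow> int \<Rightarrow> int \<Rightarrow> bool" where
  "gl2_iso_weyl T W mu1 mu2 \<longleftrightarrow>
     (\<exists>\<phi> :: (nat \<Rightarrow> 'k) \<Rightarrow> 'k^'n.
        bij_betw \<phi> (weyl_space mu1 mu2) W \<and>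
        (\<forall>a. \<forall>c\<in>weyl_space mu1 mu2. \<forall>d\<in>weyl_space mu1 mu2.
            \<phi> (\<lambda>k. a * c k + d k) = a *s \<phi> c + \<phi> d) \<and>
        (\<forall>i\<in>{1,2}. \<forall>j\<in>{1,2}. \<forall>c\<in>weyl_space mu1 mu2.
            \<phi> (weyl_act mu1 mu2 i j c) = T i j 1 *v \<phi> c))"

definition gl2_weyl_decomp :: "(nat \<Rightarrow> nat \<Rightarrow> nat \<Rightarrow> 'k::field^'n^'n) \<Rightarrow> nat \<Rightarrow> (nat \<Rightarrow> int) \<Rightarrow> (nat \<Rightarrow> int) \<Rightarrow> bool" where
  "gl2_weyl_decomp T m mu1 mu2 \<longleftrightarrow>
     (\<exists>W :: nat \<Rightarrow> ('k^'n) set.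
        (\<forall>j<m. vec.subspace (W j) \<and> gl2_iso_weyl T (W j) (mu1 j) (mu2 j)) \<and>
        (\<forall>v. \<exists>!w. (\<forall>j<m. w j \<in> W j) \<and> (\<forall>j\<ge>m. w j = 0) \<and> v = (\<Sum>j<m. w j)))"

text \<open>Series in u^-1: lambda_i(u) as an element of k((u^-1)), where fls_X = u^-1.\<close>
definition lam_series :: "(nat \<Rightarrow> nat \<Rightarrow> 'k::field) \<Rightarrow> nat \<Rightarrow> 'k fls" where
  "lam_series lam i = fps_to_fls (Abs_fps (\<lambda>r. if r = 0 then 1 else lam i r))"

text \<open>A polynomial P(u) viewed in k((u^-1)), where u = fls_X_inv.\<close>
definition poly_in_u :: "'k::field poly \<Rightarrow> 'k fls" where
  "poly_in_u P = (\<Sum>k\<le>degree P. fls_const (coeff P k) * fls_X_inv ^ k)"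

end

theory Submission
  imports Defs "HOL-Number_Theory.Cong"
begin

text \<open>Let \<open>B(u) = t_11(u) t_11(u - 1) \<dots> t_11(u - p + 1)\<close>. Since the shifts by \<open>0, \<dots>, p - 1\<close> form a cycle
in characteristic \<open>p\<close>, the unwanted terms of the algebraic Bethe ansatz cancel and \<open>B(u)\<close> is central,
so on the irreducible module \<open>L\<close> it is a scalar. It acts on the highest weight vector \<open>\<xi>\<close> by
\<open>\<Prod>_j \<lambda>_1(u - j)\<close>. If \<open>\<xi>\<close> has \<open>sl_2\<close>-weight \<open>n\<close>, then the hypothesis on the Weyl modules forces
\<open>n \<le> p - 2\<close> and \<open>t_11(u) f^n \<xi> = \<lambda>_2(u) f^n \<xi>\<close>, so that \<open>B(u)\<close> is also \<open>\<Prod>_j \<lambda>_2(u - j)\<close>. (For \<open>n = 0\<close> one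
finds \<open>\<lambda>_1 = \<lambda>_2\<close> directly.) Finite dimension makes \<open>\<lambda>_1/\<lambda>_2\<close> a rational function, which
therefore has norm 1 for the automorphism \<open>u \<mapsto> u + 1\<close> of order \<open>p\<close>, and Hilbert's Theorem 90 writes it as
\<open>P(u + 1)/P(u)\<close>.\<close>

unbundle no fps_syntax

section \<open>Evaluation of the generating series\<close>

definition smat :: "'a::comm_ring_1 \<Rightarrow> 'a^'n^'m \<Rightarrow> 'a^'n^'m" (infixr "*m" 75) where
  "c *m A = (\<chi> i j. c * A $ i $ j)"

lemma smat_nth [simp]: "(c *m A) $ i $ j = c * A $ i $ j"
  by (simp add: smat_def)

lemma smat_mult_left: "(c *m A) ** B = c *m (A ** B)"
  by (simp add: vec_eq_iff matrix_matrix_mult_def sum_distrib_left mult.assoc)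

lemma smat_mult_right: "A ** (c *m B) = c *m (A ** B)"
  by (simp add: vec_eq_iff matrix_matrix_mult_def sum_distrib_left mult_ac)

lemma smat_smat: "a *m b *m A = (a * b) *m A"
  by (simp add: vec_eq_iff mult.assoc)

lemma smat_linear:
  "c *m (A + B) = c *m A + c *m B" "c *m (A - B) = c *m A - c *m B"
  "c *m (- A) = - (c *m A)" "c *m 0 = 0"
  "(a + b) *m A = a *m A + b *m A" "(a - b) *m A = a *m A - b *m A"
  "(- a) *m A = - (a *m A)" "0 *m A = 0" "1 *m A = A"
  by (simp_all add: vec_eq_iff algebra_simps)

lemma matrix_mult_linear:
  fixes A B C :: "'a::ring_1^'n^'n"
  shows "(A + B) ** C = A ** C + B ** C" "(A - B) ** C = A ** C - B ** C"
  "A ** (B + C) = A ** B + A ** C" "A ** (B - C) = A ** B - A ** C"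
  "(- A) ** C = - (A ** C)" "A ** (- C) = - (A ** C)" "0 ** C = 0" "A ** 0 = 0"
  by (simp_all add: vec_eq_iff matrix_matrix_mult_def algebra_simps sum.distrib sum_subtractf sum_negf)

lemmas mat_alg = smat_mult_left smat_mult_right smat_smat smat_linear matrix_mult_linear
  matrix_mul_assoc

lemma smat_cancel:
  fixes A B :: "'a::idom^'n^'m"
  assumes "c *m A = c *m B" "c \<noteq> 0"
  shows "A = B"
  using assms by (simp add: vec_eq_iff)

text \<open>Counterpart of \<open>comm\<close> for entries in a commutative ring: the matrices below
  have power series as entries, and these do not form a field.\<close>

definition brak :: "'a::comm_ring_1^'n^'n \<Rightarrow> 'a^'n^'n \<Rightarrow> 'a^'n^'n" where
  "brak A B = A ** B - B ** A"

definition cmat :: "'k::field^'n^'n \<Rightarrow> 'k fps^'n^'n" where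
  "cmat A = map_matrix fps_const A"

lemma cmat_nth [simp]: "cmat A $ i $ j = fps_const (A $ i $ j)"
  by (simp add: cmat_def)

text \<open>\<open>tval T i j b\<close> is \<open>t_ij(u)\<close> with \<open>u\<close> replaced by \<open>1/b\<close>, for a power series \<open>b\<close> without
constant term.\<close>
definition tval :: "(nat \<Rightarrow> nat \<Rightarrow> nat \<Rightarrow> 'k::field^'n^'n) \<Rightarrow> nat \<Rightarrow> nat \<Rightarrow> 'k fps \<Rightarrow> 'k fps^'n^'n" where
  "tval T i j b = (\<chi> \<alpha> \<beta>. Abs_fps (\<lambda>r. tgen T i j r $ \<alpha> $ \<beta>) oo b)"

definition mcomp :: "'k::field fps^'n^'n \<Rightarrow> 'k fps \<Rightarrow> 'k fps^'n^'n" where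
  "mcomp A b = map_matrix (\<lambda>F. F oo b) A"

lemma mcomp_nth [simp]: "mcomp A b $ i $ j = (A $ i $ j) oo b"
  by (simp add: mcomp_def)

lemma mcomp_mult: "fps_nth b 0 = 0 \<Longrightarrow> mcomp (A ** B) b = mcomp A b ** mcomp B b"
  by (simp add: vec_eq_iff matrix_matrix_mult_def fps_compose_sum_distrib fps_compose_mult_distrib)

lemma mcomp_diff: "mcomp (A - B) b = mcomp A b - mcomp B b"
  by (simp add: vec_eq_iff fps_compose_sub_distrib)

lemma mcomp_smat: "fps_nth b 0 = 0 \<Longrightarrow> mcomp (c *m A) b = (c oo b) *m mcomp A b"
  by (simp add: vec_eq_iff fps_compose_mult_distrib)

lemma mcomp_cmat: "mcomp (cmat A) b = cmat A"
  by (simp add: vec_eq_iff)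

lemma tval_X_nth: "tval T i j fps_X $ \<alpha> $ \<beta> = Abs_fps (\<lambda>r. tgen T i j r $ \<alpha> $ \<beta>)"
  by (simp add: tval_def)

lemma mcomp_tval: "fps_nth b 0 = 0 \<Longrightarrow> fps_nth c 0 = 0 \<Longrightarrow> mcomp (tval T i j c) b = tval T i j (c oo b)"
  by (simp add: vec_eq_iff tval_def fps_compose_assoc)

text \<open>Multiply the relation for r, s by u^-(r+1) and sum over r, with s fixed. The missing
  term [t_ij^(0), t_kl^(s)] is zero, so the sum completes to t_ij(u); here \<open>fps_X\<close> is
  1/u.\<close>

lemma comm_tval_cmat_X:
  assumes T: "yangian_rep T" and ij: "i \<in> {1,2}" "j \<in> {1,2}" "k \<in> {1,2}" "l \<in> {1,2}"
  shows "brak (tval T i j fps_X) (cmat (tgen T k l s))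
      - fps_X *m brak (tval T i j fps_X) (cmat (tgen T k l (Suc s)))
    = fps_X *m (tval T k j fps_X ** cmat (tgen T i l s) - cmat (tgen T k j s) ** tval T i l fps_X)"
proof -
  have coeff_left: "fps_nth ((tval T i j fps_X ** cmat M) $ \<alpha> $ \<beta>) r = (tgen T i j r ** M) $ \<alpha> $ \<beta>"
    for i j M \<alpha> \<beta> r
    by (simp add: matrix_matrix_mult_def fps_sum_nth tval_X_nth)
  have coeff_right: "fps_nth ((cmat M ** tval T i j fps_X) $ \<alpha> $ \<beta>) r = (M ** tgen T i j r) $ \<alpha> $ \<beta>"
    for i j M \<alpha> \<beta> r
    by (simp add: matrix_matrix_mult_def fps_sum_nth tval_X_nth)
  have zero: "tgen T i j 0 ** M = M ** tgen T i j 0" for M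
    by (simp add: tgen_def mat_alg)
  have rel: "(comm (tgen T i j (Suc r)) (tgen T k l s)
      - comm (tgen T i j r) (tgen T k l (Suc s))) $ \<alpha> $ \<beta>
      = (tgen T k j r ** tgen T i l s - tgen T k j s ** tgen T i l r) $ \<alpha> $ \<beta>" for r \<alpha> \<beta>
    using T ij unfolding yangian_rep_def by (metis (no_types))
  show ?thesis
    apply (simp add: vec_eq_iff fps_eq_iff)
    apply (intro allI)
    subgoal for \<alpha> \<beta> r
      \<comment> \<open>The factor \<open>fps_X\<close> moves the index by one; the coefficient r =
        0 is settled by \<open>zero\<close>.\<close>
      using rel[of "r - 1" \<alpha> \<beta>]
      by (cases r) (simp_all add: comm_def brak_def coeff_left coeff_right zero)
    done
qed

lemma comm_tval_cmat:
  assumes T: "yangian_rep T" and ij: "i \<in> {1,2}" "j \<in> {1,2}" "k \<in> {1,2}" "l \<in> {1,2}"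
    and b: "fps_nth b 0 = 0"
  shows "brak (tval T i j b) (cmat (tgen T k l s))
      - b *m brak (tval T i j b) (cmat (tgen T k l (Suc s)))
    = b *m (tval T k j b ** cmat (tgen T i l s) - cmat (tgen T k j s) ** tval T i l b)"
  using arg_cong[OF comm_tval_cmat_X[OF T ij, of s], where f = "\<lambda>A. mcomp A b"] b
  by (simp add: comm_def brak_def mcomp_diff mcomp_mult mcomp_smat mcomp_cmat mcomp_tval)

text \<open>Truncation of \<open>tval T i j c\<close>. When b and c are series in the same variable,
  coefficients in 1/v cannot be compared separately, so the second generating series is built up by
  partial sums.\<close>

definition tpart :: "(nat \<Rightarrow> nat \<Rightarrow> nat \<Rightarrow> 'k::field^'n^'n) \<Rightarrow> nat \<Rightarrow> nat \<Rightarrow> 'k fps \<Rightarrow> nat \<Rightarrow> 'k fps^'n^'n" where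
  "tpart T i j c N = (\<Sum>s\<le>N. c ^ s *m cmat (tgen T i j s))"

lemma tval_tpart:
  assumes c: "fps_nth c 0 = 0"
  shows "\<exists>R. tval T i j c = tpart T i j c N + fps_X ^ Suc N *m R"
proof -
  define D where "D = tval T i j c - tpart T i j c N"
  have "fps_nth (D $ \<alpha> $ \<beta>) n = 0" if n: "n \<le> N" for \<alpha> \<beta> n
  proof -
    have "(\<Sum>s\<le>N. tgen T i j s $ \<alpha> $ \<beta> * fps_nth (c ^ s) n) = (\<Sum>s\<in>{0..n}. tgen T i j s $ \<alpha> $ \<beta> * fps_nth (c ^ s) n)"
      by (rule sum.mono_neutral_right) (use n c in \<open>auto intro: startsby_zero_power_prefix[rule_format]\<close>)
    then show ?thesis
      by (simp add: D_def tpart_def tval_def fps_compose_nth fps_sum_nth mult.commute)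
  qed
  then have "D = fps_X ^ Suc N *m map_matrix (fps_shift (Suc N)) D"
    by (auto simp add: vec_eq_iff fps_eq_iff fps_X_power_mult_nth not_less simp del: power_Suc)
  then show ?thesis
    unfolding D_def by (metis add.commute diff_add_cancel)
qed

text \<open>Sum of c^(s+1) times \<open>comm_tval_cmat\<close> over s \<le> N. The second bracket
  collects the indices 1 to N + 1, hence \<open>Suc N\<close>; its index 0 term is free because
  t_kl^(0) is scalar.\<close>

lemma comm_tval_tpart:
  assumes T: "yangian_rep T" and ij: "i \<in> {1,2}" "j \<in> {1,2}" "k \<in> {1,2}" "l \<in> {1,2}"
    and b: "fps_nth b 0 = 0"
  shows "c *m brak (tval T i j b) (tpart T k l c N) - b *m brak (tval T i j b) (tpart T k l c (Suc N))
    = (b * c) *m (tval T k j b ** tpart T i l c N - tpart T k j c N ** tval T i l b)"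
proof (induction N)
  case 0
  have zero: "brak (tval T i j b) (cmat (tgen T k l 0)) = 0"
    by (auto simp: comm_def brak_def vec_eq_iff tgen_def matrix_matrix_mult_def mat_def if_distrib[of fps_const]
      if_distrib[of "\<lambda>x. x * _"] if_distrib[of "\<lambda>x. _ * x"] cong: if_cong)
  show ?case
    using arg_cong[OF comm_tval_cmat[OF T ij b, of 0], where f = "\<lambda>A. c *m A"] zero
    by (simp add: tpart_def comm_def brak_def mat_alg algebra_simps)
next
  case (Suc N)
  have tpart_Suc: "tpart T i j c (Suc N) = tpart T i j c N + c ^ Suc N *m cmat (tgen T i j (Suc N))"
    for i j N by (simp add: tpart_def)
  define x where "x = c ^ Suc N"
  have cx: "c ^ Suc (Suc N) = c * x" by (simp add: x_def)
  have split1: "c *m brak t (A + x *m X) - b *m brak t ((A + x *m X) + (c * x) *m X')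
      = (c *m brak t A - b *m brak t (A + x *m X)) + (c * x) *m (brak t X - b *m brak t X')"
    for t A X X' :: "'a fps^'b^'b"
    by (simp add: brak_def mat_alg algebra_simps)
  have split2: "(b * c) *m (t ** (A + x *m X) - (A' + x *m X') ** t')
      = (b * c) *m (t ** A - A' ** t') + (c * x) *m b *m (t ** X - X' ** t')"
    for t t' A A' X X' :: "'a fps^'b^'b"
    by (simp add: brak_def mat_alg algebra_simps)
  show ?case
    using Suc comm_tval_cmat[OF T ij b, of "Suc N"]
    unfolding tpart_Suc[of _ _ "Suc N"] tpart_Suc[of _ _ N] cx x_def[symmetric]
    by (simp only: split1 split2)
qed

text \<open>With \<open>b = 1/u\<close> and \<open>c = 1/v\<close> this is the defining relation of the Yangian multiplied by \<open>b c\<close>. Both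
\<open>b\<close> and \<open>c\<close> may be series in the same variable, so shifts \<open>v = u - 1\<close> are covered.\<close>
lemma comm_tval_tval:
  assumes T: "yangian_rep T" and ij: "i \<in> {1,2}" "j \<in> {1,2}" "k \<in> {1,2}" "l \<in> {1,2}"
    and b: "fps_nth b 0 = 0" and c: "fps_nth c 0 = 0"
  shows "(c - b) *m brak (tval T i j b) (tval T k l c)
    = (b * c) *m (tval T k j b ** tval T i l c - tval T k j c ** tval T i l b)" (is "?L = ?R")
proof -
  \<comment> \<open>Truncation at N changes both sides only by multiples of X^(N+1), and N is
    arbitrary.\<close>
  have "\<exists>E. ?L - ?R = fps_X ^ Suc N *m E" for N
  proof -
    define x :: "'a fps" where "x = fps_X ^ Suc N"
    obtain R where R: "tval T k l c = tpart T k l c N + x *m R"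
      using tval_tpart[OF c] unfolding x_def by blast
    \<comment> \<open>One order more, since \<open>comm_tval_tpart\<close> has \<open>Suc N\<close>
      in the term with b.\<close>
    obtain R' where R': "tval T k l c = tpart T k l c (Suc N) + fps_X *m x *m R'"
      using tval_tpart[OF c, of T k l "Suc N"] unfolding x_def smat_smat by auto
    obtain Q where Q: "tval T i l c = tpart T i l c N + x *m Q"
      using tval_tpart[OF c] unfolding x_def by blast
    obtain S where S: "tval T k j c = tpart T k j c N + x *m S"
      using tval_tpart[OF c] unfolding x_def by blast
    have "?L = c *m brak (tval T i j b) (tpart T k l c N + x *m R)
        - b *m brak (tval T i j b) (tpart T k l c (Suc N) + fps_X *m x *m R')"
      unfolding R[symmetric] R'[symmetric] by (simp add: mat_alg)
    also have "\<dots> = (c *m brak (tval T i j b) (tpart T k l c N)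
         - b *m brak (tval T i j b) (tpart T k l c (Suc N)))
        + x *m (c *m brak (tval T i j b) R - b *m fps_X *m brak (tval T i j b) R')"
      by (simp add: comm_def brak_def mat_alg algebra_simps)
    finally have L: "?L = \<dots>" .
    have "?R = (b * c) *m (tval T k j b ** (tpart T i l c N + x *m Q) - (tpart T k j c N + x *m S) ** tval T i l b)"
      unfolding Q[symmetric] S[symmetric] ..
    also have "\<dots> = (b * c) *m (tval T k j b ** tpart T i l c N - tpart T k j c N ** tval T i l b)
       + x *m ((b * c) *m (tval T k j b ** Q - S ** tval T i l b))"
      by (simp add: mat_alg algebra_simps)
    finally have "?L - ?R = x *m (c *m brak (tval T i j b) R - b *m fps_X *m brak (tval T i j b) R')
       - x *m ((b * c) *m (tval T k j b ** Q - S ** tval T i l b))"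
      using L comm_tval_tpart[OF T ij b, of c N] by simp
    then show ?thesis
      unfolding x_def smat_linear(2)[symmetric] by blast
  qed
  then have "fps_nth ((?L - ?R) $ \<alpha> $ \<beta>) n = 0" for \<alpha> \<beta> n
    by (metis (no_types, lifting) smat_nth fps_X_power_mult_nth lessI)
  then have "?L - ?R = 0"
    by (simp add: vec_eq_iff fps_eq_iff)
  then show ?thesis by simp
qed

section \<open>The central product of shifts\<close>

lemma matrix_commute_mult:
  fixes A B C :: "'a::comm_ring_1^'n^'n"
  assumes "A ** B = B ** A" "A ** C = C ** A"
  shows "A ** (B ** C) = (B ** C) ** A"
proof -
  have "A ** (B ** C) = B ** A ** C" by (simp only: matrix_mul_assoc assms(1))
  also have "\<dots> = (B ** C) ** A" by (simp only: matrix_mul_assoc[symmetric] assms(2))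
  finally show ?thesis .
qed

lemma brak_eq_0_iff: "brak A B = 0 \<longleftrightarrow> A ** B = B ** A"
  by (simp add: brak_def)

text \<open>\<open>shiftser j\<close> is \<open>1/(u - j)\<close> as a power series in \<open>1/u\<close>.\<close>
definition shiftser :: "nat \<Rightarrow> 'k::field fps" where
  "shiftser j = fps_X * inverse (1 - of_nat j * fps_X)"

lemma shiftser_mult: "shiftser j * (1 - of_nat j * fps_X) = (fps_X :: 'k::field fps)"
  by (simp add: shiftser_def mult.assoc inverse_mult_eq_1)

lemma shiftser_nth_0 [simp]: "fps_nth (shiftser j) 0 = 0"
  by (simp add: shiftser_def)

lemma shiftser_neq_0 [simp]: "shiftser j \<noteq> (0 :: 'k::field fps)"
proof
  assume "shiftser j = (0 :: 'k fps)"
  then show False using shiftser_mult[of j, where 'k='k] by simp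
qed

text \<open>Subtraction of the fractions 1/(u - j - 1) and 1/(u - j). For adjacent shifts the
  factors c - b and b c of \<open>comm_tval_tval\<close> thus agree and cancel.\<close>

lemma shiftser_diff:
  "shiftser (Suc j) - shiftser j = shiftser j * (shiftser (Suc j) :: 'k::field fps)"
proof -
  let ?d = "1 - of_nat j * fps_X :: 'k fps" and ?d' = "1 - of_nat (Suc j) * fps_X :: 'k fps"
  have d: "?d \<noteq> 0" "?d' \<noteq> 0"
    using shiftser_mult[of j, where 'k='k] shiftser_mult[of "Suc j", where 'k='k] by auto
  have "?d * ?d' * (shiftser (Suc j) - shiftser j)
    = ?d * (shiftser (Suc j) * ?d') - ?d' * (shiftser j * ?d)" by (simp add: algebra_simps)
  also have "\<dots> = fps_X * fps_X"
    unfolding shiftser_mult by (simp add: algebra_simps)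
  also have "\<dots> = (shiftser j * ?d) * (shiftser (Suc j) * ?d')"
    unfolding shiftser_mult ..
  also have "\<dots> = ?d * ?d' * (shiftser j * shiftser (Suc j))" by (simp add: algebra_simps)
  finally show ?thesis using d by simp
qed

text \<open>The product t_11(u - j) ... t_11(u - j - k + 1); B(u) is the case j = 0, k = p.\<close>

fun shift_prod :: "(nat \<Rightarrow> nat \<Rightarrow> nat \<Rightarrow> 'k::field^'n^'n) \<Rightarrow> nat \<Rightarrow> nat \<Rightarrow> 'k fps^'n^'n" where
  "shift_prod T j 0 = mat 1"
| "shift_prod T j (Suc k) = tval T 1 1 (shiftser j) ** shift_prod T (Suc j) k"

context
  fixes T :: "nat \<Rightarrow> nat \<Rightarrow> nat \<Rightarrow> 'k::field^'n^'n"
  assumes T: "yangian_rep T"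
begin

text \<open>After cancelling c - b = b c, the term t_21(u - j - 1) t_11(u - j) occurs on both sides
  and drops out.\<close>

lemma tval_11_21_shift:
  "tval T 1 1 (shiftser j) ** tval T 2 1 (shiftser (Suc j))
    = tval T 2 1 (shiftser j) ** tval T 1 1 (shiftser (Suc j))"
proof -
  let ?b = "shiftser j :: 'k fps" and ?c = "shiftser (Suc j) :: 'k fps"
  have "(?b * ?c) *m brak (tval T 1 1 ?b) (tval T 2 1 ?c)
    = (?b * ?c) *m (tval T 2 1 ?b ** tval T 1 1 ?c - tval T 2 1 ?c ** tval T 1 1 ?b)"
    using comm_tval_tval[OF T, of 1 1 2 1 ?b ?c] by (simp add: shiftser_diff)
  then have "brak (tval T 1 1 ?b) (tval T 2 1 ?c)
    = tval T 2 1 ?b ** tval T 1 1 ?c - tval T 2 1 ?c ** tval T 1 1 ?b"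
    by (rule smat_cancel) simp
  then show ?thesis by (simp add: brak_def)
qed

text \<open>The relation reads (c - b) D = b c D for the commutator D, which says nothing for
  adjacent shifts. Exchanging b and c reverses one sign, and adding gives 2 (c - b) D = 0.\<close>

lemma tval_11_commute:
  assumes b: "fps_nth b 0 = 0" and c: "fps_nth c 0 = 0" and two: "(2 :: 'k) \<noteq> 0"
  shows "tval T 1 1 b ** tval T 1 1 c = tval T 1 1 c ** tval T 1 1 b"
proof (cases "b = c")
  case False
  let ?D = "tval T 1 1 b ** tval T 1 1 c - tval T 1 1 c ** tval T 1 1 b"
  have "(c - b) *m ?D = (b * c) *m ?D"
    using comm_tval_tval[OF T, of 1 1 1 1 b c] b c by (simp add: brak_def)
  moreover have "(b - c) *m (- ?D) = (b * c) *m (- ?D)"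
    using comm_tval_tval[OF T, of 1 1 1 1 c b] b c by (simp add: brak_def mult.commute)
  then have "(c - b) *m ?D = - ((b * c) *m ?D)"
    by (simp add: smat_linear algebra_simps)
  ultimately have "(c - b) *m ?D + (c - b) *m ?D = (b * c) *m ?D + - ((b * c) *m ?D)"
    by (rule arg_cong2[where f = "(+)"])
  then have "(2 * (c - b)) *m ?D = 0"
    by (simp only: mult_2 smat_linear(5) right_minus)
  moreover have "2 * (c - b) \<noteq> 0"
  proof -
    have "fps_nth (2 :: 'k fps) 0 = 2" by (rule fps_numeral_nth_0)
    with two have "(2 :: 'k fps) \<noteq> 0" by (metis fps_zero_nth)
    moreover have "c - b \<noteq> 0" using False by simp
    ultimately show ?thesis by (rule no_zero_divisors)
  qed
  ultimately have "?D = 0"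
    using smat_cancel[of "2 * (c - b)" ?D 0] unfolding smat_linear by blast
  then show ?thesis by simp
qed simp

text \<open>The unwanted terms in the commutation with \<open>t_21\<close> are proportional to the residue \<open>j\<close>,
hence vanish at both ends of the cycle \<open>p = 0, p - 1, \<dots>, 0\<close> of shifts.\<close>
lemma shift_prod_commutation:
  fixes a :: 'k
  defines "c \<equiv> fps_const a * fps_X"
  defines "m \<equiv> \<lambda>j. c * (1 - of_nat j * fps_X) - fps_X"
  assumes p: "of_nat p = (0 :: 'k)" and a: "a \<noteq> 1" and k: "k \<le> p"
  shows "m (p - k) *m (shift_prod T (p - k) k ** tval T 2 1 c)
     = m 0 *m (tval T 2 1 c ** shift_prod T (p - k) k)
     - (of_nat (p - k) * (fps_X * c)) *m
        (tval T 2 1 (shiftser (p - k)) ** shift_prod T (Suc (p - k)) (k - 1) ** tval T 1 1 c)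
   \<and> shift_prod T (p - k) k ** tval T 1 1 c = tval T 1 1 c ** shift_prod T (p - k) k"
  using k
proof (induction k)
  case 0
  \<comment> \<open>The empty product starts at shift p, and p = 0 in the field: \<open>m p\<close>
    is \<open>m 0\<close> and the unwanted term vanishes.\<close>
  have "of_nat p = (0 :: 'k fps)" by (subst fps_of_nat[symmetric]) (simp only: p fps_const_0_eq_0)
  then show ?case by (simp add: m_def mat_alg)
next
  case (Suc k)
  \<comment> \<open>The product grows by prepending t_11(u - j), so the starting shift descends from
    p.\<close>
  define j where "j = p - Suc k"
  have pk: "p - k = Suc j" using Suc.prems by (simp add: j_def)
  let ?A = "shift_prod T (Suc j) k" and ?Y = "tval T 2 1 c" and ?Z = "tval T 1 1 c"
    and ?a = "tval T 1 1 (shiftser j)" and ?c = "tval T 2 1 (shiftser j)"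
  define W where "W = tval T 2 1 (shiftser (Suc j)) ** shift_prod T (Suc (Suc j)) (k - 1) ** ?Z"
  have c0: "fps_nth c 0 = 0" by (simp add: c_def)
  have m_neq: "m i \<noteq> 0" for i
  proof -
    have "fps_nth (m i) 1 = a - 1"
      by (simp add: m_def c_def mult.assoc)
    then show ?thesis using a by auto
  qed
  have m_Suc: "m i = m (Suc i) + fps_X * c" for i
    by (simp add: m_def algebra_simps)
  have m_0: "m 0 = m i + of_nat i * (fps_X * c)" for i
    by (simp add: m_def algebra_simps)
  \<comment> \<open>Multiplying by 1 - jX clears the denominator of 1/(u - j) and turns c - b into
    \<open>m j\<close>.\<close>
  have d2: "(1 - of_nat j * fps_X) * (shiftser j * c) = fps_X * c"
  proof -
    have "(1 - of_nat j * fps_X) * (shiftser j * c) = shiftser j * (1 - of_nat j * fps_X) * c"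
      by (simp only: mult_ac)
    then show ?thesis by (simp only: shiftser_mult)
  qed
  have "(1 - of_nat j * fps_X) * (c - shiftser j) = c * (1 - of_nat j * fps_X) - shiftser j * (1 - of_nat j * fps_X)"
    by (simp add: algebra_simps)
  then have d1: "(1 - of_nat j * fps_X) * (c - shiftser j) = m j"
    by (simp add: m_def shiftser_mult)
  have rel: "m j *m brak ?a (tval T k l c)
     = (fps_X * c) *m (tval T k 1 (shiftser j) ** tval T 1 l c - tval T k 1 c ** tval T 1 l (shiftser j))"
    if "k \<in> {1,2}" "l \<in> {1,2}" for k l
    using arg_cong[OF comm_tval_tval[OF T _ _ that shiftser_nth_0 c0, of 1 1 j],
        where f = "\<lambda>A. (1 - of_nat j * fps_X) *m A"]
    by (simp add: smat_smat d1 d2)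
  \<comment> \<open>For k = l = 1 the right side of \<open>rel\<close> is again a multiple of the
    bracket, and the two coefficients subtract to \<open>m (Suc j)\<close>.\<close>
  have aZ: "?a ** ?Z = ?Z ** ?a"
  proof -
    have "(m (Suc j) + fps_X * c) *m brak ?a ?Z = (fps_X * c) *m brak ?a ?Z"
      using rel[of 1 1] m_Suc[of j] by (simp add: brak_def)
    then have "m (Suc j) *m brak ?a ?Z = m (Suc j) *m 0"
      by (simp add: smat_linear)
    then have "brak ?a ?Z = 0" by (rule smat_cancel) (rule m_neq)
    then show ?thesis by (simp add: brak_eq_0_iff)
  qed
  have aY: "m j *m (?a ** ?Y) = m (Suc j) *m (?Y ** ?a) + (fps_X * c) *m (?c ** ?Z)"
    using rel[of 2 1] m_Suc[of j] by (simp add: brak_def smat_linear algebra_simps)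
  have IH1: "m (Suc j) *m (?A ** ?Y) = m 0 *m (?Y ** ?A) - (of_nat (Suc j) * (fps_X * c)) *m W"
    and IH2: "?A ** ?Z = ?Z ** ?A"
    using Suc.IH Suc.prems unfolding pk W_def by auto
  \<comment> \<open>The exchange \<open>tval_11_21_shift\<close> brings the old unwanted term to the
    shape of the new one. For k = 0, W is only a placeholder, multiplied by p = 0.\<close>
  have aW: "(of_nat (Suc j) :: 'k fps) *m (?a ** W) = of_nat (Suc j) *m (?c ** ?A ** ?Z)"
  proof (cases k)
    case 0
    then have "p = Suc j" using pk by simp
    then have "of_nat (Suc j) = (0 :: 'k fps)"
      using p by (subst fps_of_nat[symmetric]) (simp only: fps_const_0_eq_0)
    then show ?thesis by (simp add: smat_linear del: of_nat_Suc)
  next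
    case (Suc k')
    have "?a ** W = (?a ** tval T 2 1 (shiftser (Suc j))) ** shift_prod T (Suc (Suc j)) k' ** ?Z"
      by (simp add: W_def Suc matrix_mul_assoc)
    also have "\<dots> = ?c ** ?A ** ?Z"
      by (simp add: tval_11_21_shift Suc matrix_mul_assoc del: One_nat_def)
    finally show ?thesis by simp
  qed
  have cZA: "?c ** ?Z ** ?A = ?c ** ?A ** ?Z"
    by (simp only: IH2 matrix_mul_assoc[symmetric])
  \<comment> \<open>The two unwanted contributions combine: the factor \<open>m (Suc j)\<close>
    splits off and leaves the residue j.\<close>
  have coef: "m 0 * (fps_X * c) - m j * (fps_X * c) * of_nat (Suc j) = - (m (Suc j) * (of_nat j * (fps_X * c)))"
    unfolding m_0[of "Suc j"] m_Suc[of j] by (simp add: algebra_simps)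
  have "m (Suc j) *m (m j *m (?a ** ?A ** ?Y)) = m j *m (?a ** (m (Suc j) *m (?A ** ?Y)))"
    by (simp add: mat_alg mult.commute)
  also have "\<dots> = m 0 *m ((m j *m (?a ** ?Y)) ** ?A) - (m j * (fps_X * c)) *m (of_nat (Suc j) *m (?a ** W))"
    unfolding IH1 by (simp add: mat_alg algebra_simps del: of_nat_Suc)
  also have "\<dots> = (m 0 * m (Suc j)) *m (?Y ** ?a ** ?A)
      + (m 0 * (fps_X * c) - m j * (fps_X * c) * of_nat (Suc j)) *m (?c ** ?A ** ?Z)"
    unfolding aY aW by (simp add: mat_alg cZA del: of_nat_Suc One_nat_def)
  also have "\<dots> = m (Suc j) *m (m 0 *m (?Y ** ?a ** ?A) - (of_nat j * (fps_X * c)) *m (?c ** ?A ** ?Z))"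
    unfolding coef by (simp add: mat_alg mult_ac)
  finally have "m j *m (?a ** ?A ** ?Y) = m 0 *m (?Y ** ?a ** ?A) - (of_nat j * (fps_X * c)) *m (?c ** ?A ** ?Z)"
    by (rule smat_cancel) (rule m_neq)
  moreover have "?a ** ?A ** ?Z = ?Z ** (?a ** ?A)"
  proof -
    have "?a ** ?A ** ?Z = ?a ** ?Z ** ?A"
      by (simp only: IH2 matrix_mul_assoc[symmetric])
    then show ?thesis by (simp only: aZ matrix_mul_assoc)
  qed
  ultimately show ?case
    unfolding j_def[symmetric] by (simp add: matrix_mul_assoc)
qed

text \<open>At k = p the start is 0, so the unwanted term has coefficient 0 and both sides carry
  \<open>m 0\<close>, which is c - X. The argument aX means v = u/a, a substitute for a second
  variable; a \<noteq> 1 makes c - X nonzero.\<close>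

lemma shift_prod_commute_dilated:
  fixes a :: 'k
  assumes p: "of_nat p = (0 :: 'k)" and a: "a \<noteq> 1"
  shows "brak (shift_prod T 0 p) (tval T 2 1 (fps_const a * fps_X)) = 0"
    and "brak (shift_prod T 0 p) (tval T 1 1 (fps_const a * fps_X)) = 0"
proof -
  let ?c = "fps_const a * fps_X"
  have "fps_nth (?c - fps_X) 1 \<noteq> 0" using a by simp
  then have "?c - fps_X \<noteq> 0" by force
  moreover have "(?c - fps_X) *m (shift_prod T 0 p ** tval T 2 1 ?c)
    = (?c - fps_X) *m (tval T 2 1 ?c ** shift_prod T 0 p)"
    using shift_prod_commutation[OF p a, of p] by (simp add: smat_linear)
  ultimately have "shift_prod T 0 p ** tval T 2 1 ?c = tval T 2 1 ?c ** shift_prod T 0 p"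
    by (rule smat_cancel[rotated])
  then show "brak (shift_prod T 0 p) (tval T 2 1 ?c) = 0"
    by (simp add: brak_eq_0_iff)
  show "brak (shift_prod T 0 p) (tval T 1 1 ?c) = 0"
    using shift_prod_commutation[OF p a, of p] by (simp add: brak_eq_0_iff)
qed

end

lemma fps_nth_sum_dilated:
  fixes a :: "'a::comm_ring_1"
  shows "fps_nth (\<Sum>k\<in>K. Abs_fps (\<lambda>r. a ^ r * X r k) * G k) N
    = (\<Sum>s\<le>N. a ^ s * fps_nth (\<Sum>k\<in>K. fps_const (X s k) * G k) (N - s))"
proof -
  have "fps_nth (\<Sum>k\<in>K. Abs_fps (\<lambda>r. a ^ r * X r k) * G k) N
    = (\<Sum>k\<in>K. \<Sum>s\<le>N. a ^ s * (X s k * fps_nth (G k) (N - s)))"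
    by (simp add: fps_sum_nth fps_mult_nth atLeast0AtMost mult.assoc)
  also have "\<dots> = (\<Sum>s\<le>N. a ^ s * fps_nth (\<Sum>k\<in>K. fps_const (X s k) * G k) (N - s))"
    by (subst sum.swap) (simp add: fps_sum_nth sum_distrib_left)
  finally show ?thesis .
qed

text \<open>For fixed N the coefficient of X^N in the bracket is a polynomial in a with infinitely
  many zeros, hence zero. Its coefficient at a^s is that of X^(N - s) in the bracket with
  t_ij^(s).\<close>

lemma commute_coeffs:
  fixes T :: "nat \<Rightarrow> nat \<Rightarrow> nat \<Rightarrow> 'k::field^'n^'n"
  assumes inf: "infinite (UNIV :: 'k set)"
    and comm: "\<And>a. a \<noteq> 1 \<Longrightarrow> brak B (tval T i j (fps_const a * fps_X)) = 0"
  shows "B ** cmat (tgen T i j s) = cmat (tgen T i j s) ** B"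
proof -
  have "fps_nth (brak B (cmat (tgen T i j s)) $ \<alpha> $ \<beta>) n = 0" for \<alpha> \<beta> n
  proof -
    define D where "D s' = fps_nth (brak B (cmat (tgen T i j s')) $ \<alpha> $ \<beta>) (n + s - s')" for s'
    define P where "P = (\<Sum>s'\<le>n+s. monom (D s') s')"
    have "poly P a = 0" if "a \<noteq> 1" for a
    proof -
      have tval: "tval T i j (fps_const a * fps_X) $ \<gamma> $ \<delta> = Abs_fps (\<lambda>r. a ^ r * tgen T i j r $ \<gamma> $ \<delta>)"
        for \<gamma> \<delta> by (simp add: tval_def fps_compose_linear)
      have l: "fps_nth ((B ** tval T i j (fps_const a * fps_X)) $ \<alpha> $ \<beta>) (n + s)
        = (\<Sum>s'\<le>n+s. a ^ s' * fps_nth ((B ** cmat (tgen T i j s')) $ \<alpha> $ \<beta>) (n + s - s'))"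
        unfolding matrix_matrix_mult_def
        by (simp add: tval mult.commute[of "B $ \<alpha> $ _"] fps_nth_sum_dilated)
      have r: "fps_nth ((tval T i j (fps_const a * fps_X) ** B) $ \<alpha> $ \<beta>) (n + s)
        = (\<Sum>s'\<le>n+s. a ^ s' * fps_nth ((cmat (tgen T i j s') ** B) $ \<alpha> $ \<beta>) (n + s - s'))"
        unfolding matrix_matrix_mult_def
        by (simp add: tval fps_nth_sum_dilated)
      have "poly P a = (\<Sum>s'\<le>n+s. a ^ s' * D s')"
        by (simp add: P_def poly_sum poly_monom mult.commute)
      also have "\<dots> = fps_nth (brak B (tval T i j (fps_const a * fps_X)) $ \<alpha> $ \<beta>) (n + s)"
        by (simp add: brak_def D_def l r right_diff_distrib sum_subtractf)
      finally show ?thesis using comm[OF that] by simp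
    qed
    then have "UNIV - {1} \<subseteq> {a. poly P a = 0}" by auto
    moreover have "infinite (UNIV - {1 :: 'k})" using inf by simp
    ultimately have "P = 0" using poly_roots_finite finite_subset by blast
    then have "coeff P s = 0" by simp
    then have "D s = 0" by (simp add: P_def coeff_sum)
    then show ?thesis by (simp add: D_def)
  qed
  then have "brak B (cmat (tgen T i j s)) = 0" by (simp add: vec_eq_iff fps_eq_iff)
  then show ?thesis by (simp add: brak_eq_0_iff)
qed

section \<open>The transposed representation and centrality of B(u)\<close>

definition transp_rep :: "(nat \<Rightarrow> nat \<Rightarrow> nat \<Rightarrow> 'k::field^'n^'n) \<Rightarrow> nat \<Rightarrow> nat \<Rightarrow> nat \<Rightarrow> 'k^'n^'n" where
  "transp_rep T i j r = transpose (T j i r)"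

lemma tgen_transp_rep: "tgen (transp_rep T) i j r = transpose (tgen T j i r)"
  by (auto simp: tgen_def transp_rep_def transpose_def vec_eq_iff mat_def)

lemma tval_transp_rep: "tval (transp_rep T) i j b = transpose (tval T j i b)"
  by (simp add: tval_def tgen_transp_rep transpose_def vec_eq_iff)

lemma transpose_diff: "transpose (A - B) = transpose A - transpose (B :: 'a::group_add^'n^'m)"
  by (simp add: transpose_def vec_eq_iff)

text \<open>Transposition reverses products and negates commutators; exchanging the two indices
  restores the right-hand side. In this way t_12 and t_21 trade places.\<close>

lemma yangian_rep_transp_rep:
  assumes T: "yangian_rep T"
  shows "yangian_rep (transp_rep T)"
  unfolding yangian_rep_def
proof (intro ballI allI)
  fix i j k l :: nat and r s assume ij: "i \<in> {1,2}" "j \<in> {1,2}" "k \<in> {1,2}" "l \<in> {1,2}"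
  have "comm (tgen T j i (Suc r)) (tgen T l k s) - comm (tgen T j i r) (tgen T l k (Suc s))
       = tgen T l i r ** tgen T j k s - tgen T l i s ** tgen T j k r"
    using T ij unfolding yangian_rep_def by (metis (no_types))
  from arg_cong[OF this, where f = "\<lambda>A. - transpose A"]
  show "comm (tgen (transp_rep T) i j (Suc r)) (tgen (transp_rep T) k l s)
      - comm (tgen (transp_rep T) i j r) (tgen (transp_rep T) k l (Suc s))
      = tgen (transp_rep T) k j r ** tgen (transp_rep T) i l s
      - tgen (transp_rep T) k j s ** tgen (transp_rep T) i l r"
    by (simp add: tgen_transp_rep comm_def transpose_diff matrix_transpose_mul)
      (simp add: algebra_simps)
qed

text \<open>Transposing reverses the order of the factors, which is harmless because they commute by
  \<open>tval_11_commute\<close>.\<close>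

lemma shift_prod_transp_rep:
  fixes T :: "nat \<Rightarrow> nat \<Rightarrow> nat \<Rightarrow> 'k::field^'n^'n"
  assumes T: "yangian_rep T" and two: "(2 :: 'k) \<noteq> 0"
  shows "shift_prod (transp_rep T) j k = transpose (shift_prod T j k)"
proof (induction k arbitrary: j)
  case (Suc k)
  have "tval T 1 1 (shiftser i) ** shift_prod T j k = shift_prod T j k ** tval T 1 1 (shiftser i)" for i j
  proof (induction k arbitrary: j)
    case (Suc k)
    have "tval T 1 1 (shiftser i) ** tval T 1 1 (shiftser j)
        = tval T 1 1 (shiftser j) ** tval T 1 1 (shiftser i)"
      by (rule tval_11_commute[OF T _ _ two]) simp_all
    then show ?case
      unfolding shift_prod.simps by (rule matrix_commute_mult) (rule Suc)
  qed simp
  then show ?case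
    by (simp add: Suc tval_transp_rep matrix_transpose_mul[symmetric])
qed simp

text \<open>The dilated commutations settle t_21 and t_11, the transposed representation settles
  t_12, and t_22^(s) is t_11^(s) - [t_12^(1), t_21^(s)].\<close>

lemma shift_prod_central:
  fixes T :: "nat \<Rightarrow> nat \<Rightarrow> nat \<Rightarrow> 'k::field^'n^'n"
  assumes T: "yangian_rep T" and p: "of_nat p = (0 :: 'k)" and two: "(2 :: 'k) \<noteq> 0"
    and inf: "infinite (UNIV :: 'k set)" and ij: "i \<in> {1,2}" "j \<in> {1,2}"
  shows "shift_prod T 0 p ** cmat (tgen T i j s) = cmat (tgen T i j s) ** shift_prod T 0 p"
proof -
  let ?B = "shift_prod T 0 p"
  have c21: "?B ** cmat (tgen T 2 1 s) = cmat (tgen T 2 1 s) ** ?B" for s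
    by (rule commute_coeffs[OF inf shift_prod_commute_dilated(1)[OF T p]])
  have c11: "?B ** cmat (tgen T 1 1 s) = cmat (tgen T 1 1 s) ** ?B" for s
    by (rule commute_coeffs[OF inf shift_prod_commute_dilated(2)[OF T p]])
  have t12: "transpose ?B ** cmat (transpose (tgen T 1 2 s)) = cmat (transpose (tgen T 1 2 s)) ** transpose ?B" for s
    using commute_coeffs[OF inf shift_prod_commute_dilated(1)[OF yangian_rep_transp_rep[OF T] p]]
    unfolding shift_prod_transp_rep[OF T two] tgen_transp_rep .
  have tc: "cmat (transpose M) = transpose (cmat M)" for M :: "'k^'n^'n"
    by (simp add: vec_eq_iff transpose_def)
  have c12: "?B ** cmat (tgen T 1 2 s) = cmat (tgen T 1 2 s) ** ?B" for s
  proof -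
    have "transpose (cmat (tgen T 1 2 s) ** ?B) = transpose (?B ** cmat (tgen T 1 2 s))"
      using t12[of s] by (simp only: matrix_transpose_mul tc)
    then show ?thesis by simp
  qed
  have "comm (tgen T 1 2 (Suc 0)) (tgen T 2 1 s) - comm (tgen T 1 2 0) (tgen T 2 1 (Suc s))
       = tgen T 2 2 0 ** tgen T 1 1 s - tgen T 2 2 s ** tgen T 1 1 0"
    using T unfolding yangian_rep_def by blast
  then have "tgen T 2 2 s = tgen T 1 1 s - comm (tgen T 1 2 (Suc 0)) (tgen T 2 1 s)"
    by (simp add: tgen_def comm_def mat_alg split: if_splits)
  moreover have "cmat (A ** B) = cmat A ** cmat B" "cmat (A - B) = cmat A - cmat B" for A B :: "'k^'n^'n"
    by (simp_all add: vec_eq_iff matrix_matrix_mult_def fps_eq_iff fps_sum_nth)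
  ultimately have "cmat (tgen T 2 2 s) = cmat (tgen T 1 1 s)
     - (cmat (tgen T 1 2 (Suc 0)) ** cmat (tgen T 2 1 s) - cmat (tgen T 2 1 s) ** cmat (tgen T 1 2 (Suc 0)))"
    by (simp add: comm_def)
  then have c22: "?B ** cmat (tgen T 2 2 s) = cmat (tgen T 2 2 s) ** ?B"
  proof -
    let ?E = "cmat (tgen T 1 2 (Suc 0))" and ?F = "cmat (tgen T 2 1 s)"
    have "?B ** (?E ** ?F) = (?E ** ?F) ** ?B" "?B ** (?F ** ?E) = (?F ** ?E) ** ?B"
      by (rule matrix_commute_mult; rule c12 c21)+
    then show ?thesis
      unfolding \<open>cmat (tgen T 2 2 s) = _\<close> by (simp only: matrix_mult_linear c11)
  qed
  show ?thesis using ij c11 c12 c21 c22 by auto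
qed

section \<open>Hilbert 90 for the shift of polynomials\<close>

definition pshift :: "nat \<Rightarrow> 'a::comm_ring_1 poly \<Rightarrow> 'a poly" where
  "pshift i Q = Q \<circ>\<^sub>p [:of_nat i, 1:]"

lemma pshift_mult: "pshift i (P * Q) = pshift i P * pshift i Q"
  by (simp add: pshift_def pcompose_mult)

lemma pshift_prod: "pshift i (\<Prod>l\<in>L. f l) = (\<Prod>l\<in>L. pshift i (f l))"
  by (simp add: pshift_def pcompose_prod)

lemma pshift_sum: "pshift i (\<Sum>l\<in>L. f l) = (\<Sum>l\<in>L. pshift i (f l))"
  by (simp add: pshift_def pcompose_sum)

lemma pshift_pshift: "pshift i (pshift j Q) = pshift (i + j) Q"
  by (simp add: pshift_def pcompose_assoc[symmetric] pcompose_pCons add.commute)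

lemma pshift_0 [simp]: "pshift 0 Q = Q"
  by (simp add: pshift_def)

lemma pshift_char: "of_nat p = (0 :: 'a::comm_ring_1) \<Longrightarrow> pshift p Q = (Q :: 'a poly)"
  by (simp add: pshift_def)

lemma pshift_eq_0_iff [simp]: "pshift i Q = 0 \<longleftrightarrow> (Q :: 'a::idom poly) = 0"
  by (simp add: pshift_def pcompose_eq_0_iff)

text \<open>Evaluating the vanishing combination at the polynomial in a second variable which is zero at
all the shifts of \<open>u\<close> except \<open>u\<close> itself isolates the first coefficient.\<close>
lemma pshift_independent:
  fixes c :: "nat \<Rightarrow> 'k::field poly"
  assumes p: "CHAR('k) = p" "p > 0"
    and zero: "\<And>\<theta>. (\<Sum>i<p. c i * pshift i \<theta>) = 0"
  shows "c 0 = 0"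
proof -
  define w where "w i = [:of_nat i, 1 :: 'k:]" for i
  define g :: "'k poly poly" where "g = (\<Prod>i\<in>{1..<p}. [:- w i, 1:])"
  have w_pow: "w i ^ m = pshift i ([:0, 1:] ^ m)" for i m
    by (induction m) (simp_all add: w_def pshift_mult, simp_all add: pshift_def pcompose_1 pcompose_pCons)
  \<comment> \<open>\<open>zero\<close> for the powers of u extends linearly over k[u]: the
    coefficients of g are not shifted, only its outer variable becomes u + i.\<close>
  have "(\<Sum>i<p. c i * poly g (w i)) = (\<Sum>m\<le>degree g. coeff g m * (\<Sum>i<p. c i * w i ^ m))"
    by (simp add: poly_altdef sum_distrib_left mult_ac sum.swap[of _ "{..degree g}"])
  also have "\<dots> = 0"
    by (simp add: w_pow zero)
  also have "(\<Sum>i<p. c i * poly g (w i)) = (\<Sum>i\<in>{0}. c i * poly g (w i))"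
    by (rule sum.mono_neutral_right) (use p in \<open>auto simp: g_def poly_prod\<close>)
  finally have "c 0 * poly g (w 0) = 0" by simp
  moreover have "poly g (w 0) = (\<Prod>i\<in>{1..<p}. [:- of_nat i:])"
    by (simp add: g_def poly_prod w_def)
  moreover have "(of_nat i :: 'k) \<noteq> 0" if "i \<in> {1..<p}" for i
    using that p by (auto simp: of_nat_eq_0_iff_char_dvd dest: dvd_imp_le)
  ultimately show ?thesis by auto
qed

text \<open>Lagrange resolvent for \<sigma>: u \<mapsto> u + 1. The usual cocycle, the product of
  \<sigma>^l(A/B) over l < i, is multiplied by the norm of B to stay polynomial; this is
  \<open>c i\<close>. Equality of the norms closes the cycle.\<close>

lemma Hilbert_90_shift:
  fixes A B :: "'k::field poly"
  assumes p: "CHAR('k) = p" "p > 0" and B: "B \<noteq> 0"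
    and norm: "(\<Prod>j<p. pshift j A) = (\<Prod>j<p. pshift j B)"
  shows "\<exists>P. lead_coeff P = 1 \<and> B * P = A * pshift 1 P"
proof -
  have p0: "of_nat p = (0 :: 'k)" using p(1) of_nat_CHAR by blast
  define c where "c i = (\<Prod>l<i. pshift l A) * (\<Prod>l\<in>{i..<p}. pshift l B)" for i
  have c0: "c 0 = (\<Prod>l<p. pshift l B)" by (simp add: c_def atLeast0LessThan)
  then have "c 0 \<noteq> 0" using B by simp
  \<comment> \<open>\<open>c 0\<close> is the norm of B, so independence of the shifts provides a
    nonzero resolvent.\<close>
  then obtain \<theta> where \<theta>: "(\<Sum>i<p. c i * pshift i \<theta>) \<noteq> 0"
    using pshift_independent[OF p] by blast
  define Q where "Q = (\<Sum>i<p. c i * pshift i \<theta>)"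
  have c_Suc: "A * pshift 1 (c i) = B * c (Suc i)" if "i < p" for i
  proof -
    have "A * pshift 1 (c i) = (A * (\<Prod>l<i. pshift (Suc l) A)) * (\<Prod>l\<in>{i..<p}. pshift (Suc l) B)"
      by (simp add: c_def pshift_mult pshift_prod pshift_pshift mult.assoc)
    also have "A * (\<Prod>l<i. pshift (Suc l) A) = (\<Prod>l<Suc i. pshift l A)"
      by (subst prod.lessThan_Suc_shift) simp
    also have "(\<Prod>l\<in>{i..<p}. pshift (Suc l) B) = (\<Prod>l\<in>{Suc i..<Suc p}. pshift l B)"
      by (rule prod.shift_bounds_Suc_ivl[symmetric])
    also have "\<dots> = (\<Prod>l\<in>{Suc i..<p}. pshift l B) * B"
      using that by (simp add: pshift_char[OF p0])
    finally show ?thesis by (simp add: c_def mult_ac)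
  qed
  have "A * pshift 1 Q = (\<Sum>i<p. (A * pshift 1 (c i)) * pshift (Suc i) \<theta>)"
    by (simp add: Q_def pshift_sum pshift_mult pshift_pshift sum_distrib_left mult_ac)
  also have "\<dots> = B * (\<Sum>i<p. c (Suc i) * pshift (Suc i) \<theta>)"
    unfolding sum_distrib_left by (rule sum.cong) (simp_all add: c_Suc mult.assoc del: One_nat_def)
  \<comment> \<open>The sum loses the term 0 and gains the term p. These agree: \<open>norm\<close>
    gives \<open>c p = c 0\<close>, and the shift by p is the identity.\<close>
  also have "(\<Sum>i<p. c (Suc i) * pshift (Suc i) \<theta>) = (\<Sum>i<Suc p. c i * pshift i \<theta>) - c 0 * \<theta>"
    by (subst sum.lessThan_Suc_shift) simp
  also have "\<dots> = Q"
    using norm by (simp add: Q_def c0 pshift_char[OF p0]) (simp add: c_def)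
  finally have eq: "A * pshift 1 Q = B * Q" .
  define a where "a = lead_coeff Q"
  have a: "a \<noteq> 0" using \<theta> by (simp add: a_def Q_def)
  show ?thesis
  proof (intro exI conjI)
    show "lead_coeff (smult (inverse a) Q) = 1"
      using a by (simp add: a_def)
    show "B * smult (inverse a) Q = A * pshift 1 (smult (inverse a) Q)"
      using eq by (simp add: pshift_def pcompose_smult)
  qed
qed

section \<open>Polynomials evaluated at Laurent series in 1/u\<close>

definition leval :: "'k::field poly \<Rightarrow> 'k fls \<Rightarrow> 'k fls" where
  "leval P w = poly (map_poly fls_const P) w"

lemma leval_pCons: "leval (pCons a P) w = fls_const a + w * leval P w"
  by (simp add: leval_def map_poly_pCons)

lemma leval_0 [simp]: "leval 0 w = 0"
  by (simp add: leval_def)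

lemma leval_add: "leval (P + Q) w = leval P w + leval Q w"
  by (induction P Q rule: poly_induct2) (simp_all add: leval_pCons algebra_simps fls_plus_const)

lemma leval_smult: "leval (smult a P) w = fls_const a * leval P w"
  by (induction P) (simp_all add: leval_pCons algebra_simps fls_const_mult_const)

lemma leval_mult: "leval (P * Q) w = leval P w * leval Q w"
  by (induction P) (simp_all add: leval_pCons leval_add leval_smult algebra_simps)

lemma leval_1 [simp]: "leval 1 w = 1"
  by (simp add: leval_def)

lemma leval_prod: "leval (\<Prod>i\<in>I. f i) w = (\<Prod>i\<in>I. leval (f i) w)"
  by (induction I rule: infinite_finite_induct) (simp_all add: leval_mult)

lemma leval_pcompose: "leval (P \<circ>\<^sub>p Q) w = leval P (leval Q w)"
  by (induction P) (simp_all add: leval_pCons pcompose_pCons leval_add leval_mult)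

lemma leval_altdef:
  assumes "degree P \<le> d"
  shows "leval P w = (\<Sum>k\<le>d. fls_const (coeff P k) * w ^ k)"
proof -
  have "leval P w = (\<Sum>k\<le>degree P. fls_const (coeff P k) * w ^ k)"
    by (simp add: leval_def poly_altdef degree_map_poly coeff_map_poly)
  also have "\<dots> = (\<Sum>k\<le>d. fls_const (coeff P k) * w ^ k)"
    by (rule sum.mono_neutral_left) (use assms in \<open>auto simp: coeff_eq_0\<close>)
  finally show ?thesis .
qed

lemma poly_in_u_leval: "poly_in_u P = leval P fls_X_inv"
  by (simp add: poly_in_u_def leval_altdef[OF order.refl])

lemma poly_in_u_0 [simp]: "poly_in_u 0 = 0"
  by (simp add: poly_in_u_def)

lemma poly_in_u_eq_0_iff [simp]: "poly_in_u P = 0 \<longleftrightarrow> P = 0"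
proof
  assume P: "poly_in_u P = 0"
  have "fls_nth (poly_in_u P) (- int k) = (if k \<le> degree P then coeff P k else 0)" for k
    by (simp add: poly_in_u_def fls_nth_sum if_distrib cong: if_cong)
  then show "P = 0" using P by (auto simp: poly_eq_iff coeff_eq_0) (metis not_le coeff_eq_0)
qed (simp add: poly_in_u_def)

lemma poly_in_u_inject: "poly_in_u P = poly_in_u Q \<longleftrightarrow> P = Q"
proof -
  have "poly_in_u (P - Q) + poly_in_u Q = poly_in_u P"
    unfolding poly_in_u_leval leval_add[symmetric] by simp
  then show ?thesis
    using poly_in_u_eq_0_iff[of "P - Q"] by auto
qed

text \<open>\<open>rev_series d A\<close> is \<open>u^-d A(u)\<close> as a power series in \<open>1/u\<close>.\<close>
definition rev_series :: "nat \<Rightarrow> 'k::field poly \<Rightarrow> 'k fps" where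
  "rev_series d A = (\<Sum>i\<le>d. fps_const (coeff A i) * fps_X ^ (d - i))"

text \<open>As b = 1/w, each b^(d - i) equals b^d w^i. The reversed form lets a polynomial in u
  undergo the same substitution as the power series in 1/u.\<close>

lemma fps_to_fls_rev_series_compose:
  assumes d: "degree A \<le> d" and b: "fps_nth b 0 = 0" and w: "fps_to_fls b * w = 1"
  shows "fps_to_fls (rev_series d A oo b) = fps_to_fls b ^ d * leval A w"
proof -
  have "fps_to_fls (rev_series d A oo b) = (\<Sum>i\<le>d. fls_const (coeff A i) * fps_to_fls b ^ (d - i))"
  proof -
    have sum: "fps_to_fls (\<Sum>i\<in>I. f i) = (\<Sum>i\<in>I. fps_to_fls (f i))" for f :: "nat \<Rightarrow> 'a fps" and I
      by (induction I rule: infinite_finite_induct) simp_all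
    show ?thesis using b
      by (simp add: rev_series_def fps_compose_sum_distrib fps_compose_mult_distrib fps_compose_power[symmetric]
        sum fls_times_fps_to_fls fps_to_fls_power)
  qed
  also have "\<dots> = (\<Sum>i\<le>d. fps_to_fls b ^ d * (fls_const (coeff A i) * w ^ i))"
  proof (rule sum.cong)
    fix i assume "i \<in> {..d}"
    then have "fps_to_fls b ^ d * w ^ i = fps_to_fls b ^ (d - i) * (fps_to_fls b * w) ^ i"
      by (simp add: power_mult_distrib mult.assoc[symmetric] power_add[symmetric])
    then show "fls_const (coeff A i) * fps_to_fls b ^ (d - i)
        = fps_to_fls b ^ d * (fls_const (coeff A i) * w ^ i)"
      by (simp add: w mult.left_commute)
  qed simp
  finally show ?thesis
    by (simp add: leval_altdef[OF d] sum_distrib_left)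
qed

text \<open>The powers of 1/(u - j) are common to A and B and cancel, so A l1 = B l2 and equal norms
  of l1, l2 give equal norms of A and B. Then \<open>Hilbert_90_shift\<close> yields B/A = P(u +
  1)/P(u).\<close>

lemma quotient_of_equal_shift_products:
  fixes l1 l2 :: "'k::field fps"
  assumes p: "CHAR('k) = p" "p > 0" and A: "A \<noteq> 0"
    and l: "fps_nth l1 0 = 1" "fps_nth l2 0 = 1"
    and rat: "poly_in_u A * fps_to_fls l1 = poly_in_u B * fps_to_fls l2"
    and norm: "(\<Prod>j<p. l1 oo shiftser j) = (\<Prod>j<p. l2 oo shiftser j)"
  shows "\<exists>P. lead_coeff P = 1 \<and>
    fps_to_fls l1 / fps_to_fls l2 = poly_in_u (P \<circ>\<^sub>p [:1, 1:]) / poly_in_u P"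
proof -
  have l0: "l1 \<noteq> 0" "l2 \<noteq> 0" using l by auto
  then have B: "B \<noteq> 0" using A rat by auto
  define d where "d = max (degree A) (degree B)"
  have deg: "degree A \<le> d" "degree B \<le> d" by (simp_all add: d_def)
  define \<beta> :: "nat \<Rightarrow> 'k fls" where "\<beta> j = fps_to_fls (shiftser j)" for j
  define w :: "nat \<Rightarrow> 'k fls" where "w j = leval [:- of_nat j, 1:] fls_X_inv" for j
  have \<beta>_neq: "\<beta> j \<noteq> 0" for j by (simp add: \<beta>_def)
  have \<beta>w: "\<beta> j * w j = 1" for j
  proof -
    have X: "fls_X * fls_X_inv = (1 :: 'k fls)"
      by (simp add: fls_X_inv_times_conv_shift(2) fls_X_conv_shift_1)
    have "of_nat j = (fls_const (of_nat j) :: 'k fls)"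
      by (simp add: fls_of_nat)
    then have "w j = fls_X_inv - of_nat j"
      by (simp add: w_def leval_pCons)
    then have "w j * fls_X = fls_X * fls_X_inv - of_nat j * fls_X"
      by (simp only: left_diff_distrib mult.commute[of fls_X])
    then have "w j * fls_X = fps_to_fls (1 - of_nat j * fps_X)"
      by (simp add: X fls_times_fps_to_fls fps_to_fls_of_nat)
    then have "\<beta> j * w j * fls_X = 1 * fls_X"
      by (simp only: \<beta>_def mult.assoc fls_times_fps_to_fls[symmetric] shiftser_mult fps_X_to_fls mult_1_left)
    then show ?thesis by simp
  qed
  have X: "fps_to_fls fps_X * fls_X_inv = (1 :: 'k fls)"
    by (simp add: fls_X_inv_times_conv_shift(2) fls_X_conv_shift_1)
  have rev: "fps_to_fls (rev_series d Q) = fls_X ^ d * poly_in_u Q" if "degree Q \<le> d" for Q :: "'k poly"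
    using fps_to_fls_rev_series_compose[OF that _ X] by (simp add: poly_in_u_leval)
  have "fps_to_fls (rev_series d A * l1) = fps_to_fls (rev_series d B * l2)"
    using rat by (simp add: fls_times_fps_to_fls rev deg mult.assoc)
  then have "rev_series d A * l1 = rev_series d B * l2" by simp
  then have "(\<Prod>j<p. (rev_series d A * l1) oo shiftser j) = (\<Prod>j<p. (rev_series d B * l2) oo shiftser j)"
    by simp
  then have "(\<Prod>j<p. rev_series d A oo shiftser j) * (\<Prod>j<p. l1 oo shiftser j)
     = (\<Prod>j<p. rev_series d B oo shiftser j) * (\<Prod>j<p. l1 oo shiftser j)"
    by (simp add: fps_compose_mult_distrib prod.distrib norm)
  moreover have "l1 oo shiftser j \<noteq> 0" for j
    using l by (metis fps_compose_nth_0 fps_zero_nth zero_neq_one)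
  ultimately have "(\<Prod>j<p. rev_series d A oo shiftser j) = (\<Prod>j<p. rev_series d B oo shiftser j)"
    by simp
  then have "fps_to_fls (\<Prod>j<p. rev_series d A oo shiftser j) = fps_to_fls (\<Prod>j<p. rev_series d B oo shiftser j)"
    by simp
  moreover have "fps_to_fls (\<Prod>j<p. f j) = (\<Prod>j<p. fps_to_fls (f j))" for f :: "nat \<Rightarrow> 'k fps"
    by (induction p) (simp_all add: fls_times_fps_to_fls)
  moreover have "fps_to_fls (rev_series d Q oo shiftser j) = \<beta> j ^ d * poly_in_u (Q \<circ>\<^sub>p [:- of_nat j, 1:])"
    if "degree Q \<le> d" for Q j
    using fps_to_fls_rev_series_compose[OF that shiftser_nth_0, of j "w j"] \<beta>w[of j]
    by (simp add: \<beta>_def w_def poly_in_u_leval leval_pcompose)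
  ultimately have "(\<Prod>j<p. \<beta> j ^ d) * (\<Prod>j<p. poly_in_u (A \<circ>\<^sub>p [:- of_nat j, 1:]))
     = (\<Prod>j<p. \<beta> j ^ d) * (\<Prod>j<p. poly_in_u (B \<circ>\<^sub>p [:- of_nat j, 1:]))"
    by (simp add: prod.distrib deg)
  then have "(\<Prod>j<p. poly_in_u (A \<circ>\<^sub>p [:- of_nat j, 1:])) = (\<Prod>j<p. poly_in_u (B \<circ>\<^sub>p [:- of_nat j, 1:]))"
    using \<beta>_neq by simp
  then have "(\<Prod>j<p. A \<circ>\<^sub>p [:- of_nat j, 1:]) = (\<Prod>j<p. B \<circ>\<^sub>p [:- of_nat j, 1:])"
    by (simp add: poly_in_u_leval leval_prod[symmetric]) (simp add: poly_in_u_leval[symmetric] poly_in_u_inject)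
  \<comment> \<open>Shifting by p - 1 turns A(u - j) into A(u + p - 1 - j), so the shifts become the
    natural numbers 0 to p - 1.\<close>
  then have "pshift (p - 1) (\<Prod>j<p. A \<circ>\<^sub>p [:- of_nat j, 1:]) = pshift (p - 1) (\<Prod>j<p. B \<circ>\<^sub>p [:- of_nat j, 1:])"
    by simp
  moreover have "pshift (p - 1) (\<Prod>j<p. Q \<circ>\<^sub>p [:- of_nat j, 1:]) = (\<Prod>j<p. pshift j Q)" for Q :: "'k poly"
  proof -
    have "pshift (p - 1) (\<Prod>j<p. Q \<circ>\<^sub>p [:- of_nat j, 1:]) = (\<Prod>j<p. pshift (p - Suc j) Q)"
      unfolding pshift_prod
    proof (rule prod.cong)
      fix j assume "j \<in> {..<p}"
      then have "of_nat (p - 1) = (of_nat (p - Suc j) + of_nat j :: 'k)"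
        unfolding of_nat_add[symmetric] by (intro arg_cong[where f = of_nat]) auto
      then show "pshift (p - 1) (Q \<circ>\<^sub>p [:- of_nat j, 1:]) = pshift (p - Suc j) Q"
        by (simp add: pshift_def pcompose_assoc[symmetric] pcompose_pCons)
    qed simp
    then show ?thesis using prod.nat_diff_reindex[of "\<lambda>j. pshift j Q" p] by (rule trans)
  qed
  ultimately have "(\<Prod>j<p. pshift j A) = (\<Prod>j<p. pshift j B)" by simp
  from Hilbert_90_shift[OF p B this] obtain P where P: "lead_coeff P = 1" "B * P = A * pshift 1 P"
    by blast
  have "P \<noteq> 0" using P(1) by auto
  have "poly_in_u B * poly_in_u P = poly_in_u A * poly_in_u (P \<circ>\<^sub>p [:1, 1:])"
    using P(2) by (simp add: poly_in_u_leval leval_mult[symmetric] pshift_def)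
  then have "poly_in_u A * (fps_to_fls l1 * poly_in_u P)
      = poly_in_u A * (poly_in_u (P \<circ>\<^sub>p [:1, 1:]) * fps_to_fls l2)"
    using rat by algebra
  then have "fps_to_fls l1 * poly_in_u P = poly_in_u (P \<circ>\<^sub>p [:1, 1:]) * fps_to_fls l2"
    using A by simp
  then have "fps_to_fls l1 / fps_to_fls l2 = poly_in_u (P \<circ>\<^sub>p [:1, 1:]) / poly_in_u P"
    using l0 \<open>P \<noteq> 0\<close> by (simp add: frac_eq_eq)
  then show ?thesis using P(1) by blast
qed

section \<open>Rationality of the highest weight\<close>

lemma yangian_rel:
  assumes "yangian_rep T" "i \<in> {1,2}" "j \<in> {1,2}" "k \<in> {1,2}" "l \<in> {1,2}"
  shows "comm (tgen T i j (Suc r)) (tgen T k l s) - comm (tgen T i j r) (tgen T k l (Suc s))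
       = tgen T k j r ** tgen T i l s - tgen T k j s ** tgen T i l r"
  using assms unfolding yangian_rep_def by blast

text \<open>Otherwise x 1, ..., x N would be independent for every N, exceeding the
  dimension.\<close>

lemma exists_in_span_previous:
  fixes x :: "nat \<Rightarrow> 'k::field^'n"
  shows "\<exists>R. x (Suc R) \<in> vec.span (x ` {1..R})"
proof (rule ccontr)
  assume neg: "\<not> ?thesis"
  have "vec.independent (x ` {1..N}) \<and> card (x ` {1..N}) = N" for N
  proof (induction N)
    case (Suc N)
    have "x (Suc N) \<notin> vec.span (x ` {1..N})" using neg by blast
    moreover from this have "x (Suc N) \<notin> x ` {1..N}" using vec.span_base by blast
    moreover have "x ` {1..Suc N} = insert (x (Suc N)) (x ` {1..N})"
      by (simp add: atLeastAtMostSuc_conv)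
    ultimately show ?case using Suc by (simp add: vec.independent_insertI)
  qed (simp add: vec.independent_empty)
  then have "CARD('n) + 1 \<le> vec.dim (UNIV :: ('k^'n) set)"
    by (metis vec.independent_card_le_dim subset_UNIV)
  then show False unfolding vec_dim_card by simp
qed

text \<open>Applying \<open>t_12(u)\<close> to a linear relation among the vectors \<open>t_21^(r) \<xi>\<close> gives a linear relation
between \<open>\<lambda>_1(u)\<close> and \<open>\<lambda>_2(u)\<close> with polynomial coefficients.\<close>
lemma highest_weight_rational:
  fixes T :: "nat \<Rightarrow> nat \<Rightarrow> nat \<Rightarrow> 'k::field^'n^'n"
  assumes T: "yangian_rep T" and \<xi>: "\<xi> \<noteq> 0"
    and t12: "\<And>r. tgen T 1 2 r *v \<xi> = 0"
    and t11: "\<And>r. tgen T 1 1 r *v \<xi> = fps_nth l1 r *s \<xi>"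
    and t22: "\<And>r. tgen T 2 2 r *v \<xi> = fps_nth l2 r *s \<xi>"
    and l2: "fps_nth l2 0 = 1"
  shows "\<exists>A B. A \<noteq> 0 \<and> poly_in_u A * fps_to_fls l1 = poly_in_u B * fps_to_fls l2"
proof -
  define x where "x r = tgen T 2 1 r *v \<xi>" for r
  define rel where "rel v A B \<longleftrightarrow> (\<exists>G. (\<forall>s. tgen T 1 2 s *v v = fps_nth G s *s \<xi>) \<and>
    fps_to_fls G = poly_in_u A * fps_to_fls l1 - poly_in_u B * fps_to_fls l2)" for v A B
  \<comment> \<open>The relation trades an index of t_21 for one of t_12: from x r to x (r + 1), G
    is multiplied by u and changed by constant multiples of \<lambda>_1 and \<lambda>_2.\<close>
  have step: "tgen T 1 2 s *v x (Suc r) = tgen T 1 2 (Suc s) *v x r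
      + (fps_nth l2 r * fps_nth l1 s - fps_nth l2 s * fps_nth l1 r) *s \<xi>" for r s
  proof -
    have "(comm (tgen T 1 2 (Suc s)) (tgen T 2 1 r) - comm (tgen T 1 2 s) (tgen T 2 1 (Suc r))) *v \<xi>
       = (tgen T 2 2 s ** tgen T 1 1 r - tgen T 2 2 r ** tgen T 1 1 s) *v \<xi>"
      using yangian_rel[OF T, of 1 2 2 1 s r] by simp
    then show ?thesis
      by (simp add: comm_def matrix_vector_mult_diff_rdistrib matrix_vector_mul_assoc[symmetric] t11 t22 t12
        x_def[symmetric] vec.scale vec.zero del: One_nat_def) (simp add: vec_eq_iff algebra_simps)
  qed
  \<comment> \<open>For r > 0, A is monic of degree r - 1: the first step puts in the constant term
    1 of \<lambda>_2, and each later one multiplies by u and adds a constant.\<close>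
  have ex: "\<exists>A B. rel (x r) A B \<and> (\<forall>k\<ge>r. coeff A k = 0) \<and> (\<forall>r'. r = Suc r' \<longrightarrow> coeff A r' = 1)" for r
  proof (induction r)
    case 0
    have "rel (x 0) 0 0"
      unfolding rel_def by (rule exI[of _ 0]) (simp add: x_def tgen_def vec.zero)
    then show ?case by (metis coeff_0 nat.distinct(1))
  next
    case (Suc r)
    then obtain A B G where IH: "\<forall>k\<ge>r. coeff A k = 0" "\<forall>r'. r = Suc r' \<longrightarrow> coeff A r' = 1"
      "\<And>s. tgen T 1 2 s *v x r = fps_nth G s *s \<xi>"
      "fps_to_fls G = poly_in_u A * fps_to_fls l1 - poly_in_u B * fps_to_fls l2"
      unfolding rel_def by blast
    define A' where "A' = pCons (fps_nth l2 r) A"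
    define B' where "B' = pCons (fps_nth l1 r) B"
    define G' where "G' = fps_shift 1 G + fps_const (fps_nth l2 r) * l1 - fps_const (fps_nth l1 r) * l2"
    \<comment> \<open>t_12^(0) = 0 removes the constant term of G, so u G is still a power
      series.\<close>
    have "fps_nth G 0 *s \<xi> = 0"
      using IH(3)[of 0] by (simp add: tgen_def)
    then have G0: "fps_nth G 0 = 0" using \<xi> by (simp add: vec_eq_iff) blast
    have "G = fps_X * fps_shift 1 G"
      using G0 by (simp add: fps_eq_iff fps_X_mult_nth) 
    then have "fps_to_fls G = fls_X * fps_to_fls (fps_shift 1 G)"
      by (metis fls_times_fps_to_fls fps_X_to_fls)
    moreover have "fls_X_inv * fls_X = (1 :: 'k fls)"
      by (simp add: fls_X_inv_times_conv_shift(1) fls_X_conv_shift_1)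
    ultimately have "fps_to_fls (fps_shift 1 G) = fls_X_inv * fps_to_fls G"
      by (simp add: mult.assoc[symmetric])
    then have "fps_to_fls G' = poly_in_u A' * fps_to_fls l1 - poly_in_u B' * fps_to_fls l2"
      by (simp add: G'_def A'_def B'_def IH(4) poly_in_u_leval leval_pCons fls_times_fps_to_fls algebra_simps)
    moreover have "tgen T 1 2 s *v x (Suc r) = fps_nth G' s *s \<xi>" for s
      unfolding step IH(3) by (simp add: G'_def vec_eq_iff algebra_simps)
    ultimately have "rel (x (Suc r)) A' B'" unfolding rel_def by blast
    moreover have "\<forall>k\<ge>Suc r. coeff A' k = 0"
      using IH(1) by (auto simp: A'_def coeff_pCons split: nat.splits)
    moreover have "coeff A' r = 1"
      using IH(2) l2 by (auto simp: A'_def coeff_pCons split: nat.splits)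
    ultimately show ?case by blast
  qed
  obtain R where R: "x (Suc R) \<in> vec.span (x ` {1..R})"
    using exists_in_span_previous by blast
  \<comment> \<open>As a combination of x 1, ..., x R, this vector has a relation whose A has degree
    below R, while \<open>ex\<close> gives one with leading term u^R. Their difference is a
    nontrivial equation.\<close>
  have "\<exists>A B. rel (x (Suc R)) A B \<and> (\<forall>k\<ge>R. coeff A k = 0)"
    using R
  proof (induction rule: vec.span_induct_alt)
    case base
    have "rel 0 0 0"
      unfolding rel_def by (rule exI[of _ 0]) simp
    then show ?case by (metis coeff_0)
  next
    case (step c v w)
    then obtain r where r: "v = x r" "r \<le> R" by auto
    obtain A B where A: "rel v A B" "\<forall>k\<ge>R. coeff A k = 0"
      using ex[of r] r by (metis order.trans)
    obtain A' B' where A': "rel w A' B'" "\<forall>k\<ge>R. coeff A' k = 0"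
      using step by blast
    obtain G where G: "\<And>s. tgen T 1 2 s *v v = fps_nth G s *s \<xi>"
      "fps_to_fls G = poly_in_u A * fps_to_fls l1 - poly_in_u B * fps_to_fls l2"
      using A(1) unfolding rel_def by blast
    obtain G' where G': "\<And>s. tgen T 1 2 s *v w = fps_nth G' s *s \<xi>"
      "fps_to_fls G' = poly_in_u A' * fps_to_fls l1 - poly_in_u B' * fps_to_fls l2"
      using A'(1) unfolding rel_def by blast
    have "rel (c *s v + w) (smult c A + A') (smult c B + B')"
      unfolding rel_def
    proof (intro exI conjI allI)
      show "tgen T 1 2 s *v (c *s v + w) = fps_nth (fps_const c * G + G') s *s \<xi>" for s
        unfolding vec.add vec.scale G(1) G'(1) by (simp add: vec_eq_iff algebra_simps)
      show "fps_to_fls (fps_const c * G + G') = poly_in_u (smult c A + A') * fps_to_fls l1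
          - poly_in_u (smult c B + B') * fps_to_fls l2"
        by (simp add: G G' poly_in_u_leval leval_add leval_smult fls_times_fps_to_fls algebra_simps)
    qed
    moreover have "\<forall>k\<ge>R. coeff (smult c A + A') k = 0" using A A' by simp
    ultimately show ?case by blast
  qed
  then obtain A B where A: "rel (x (Suc R)) A B" "coeff A R = 0" by auto
  obtain A' B' where A': "rel (x (Suc R)) A' B'" "coeff A' R = 1"
    using ex[of "Suc R"] by blast
  have "poly_in_u A * fps_to_fls l1 - poly_in_u B * fps_to_fls l2
      = poly_in_u A' * fps_to_fls l1 - poly_in_u B' * fps_to_fls l2"
  proof -
    obtain G where G: "\<And>s. tgen T 1 2 s *v x (Suc R) = fps_nth G s *s \<xi>"
      "fps_to_fls G = poly_in_u A * fps_to_fls l1 - poly_in_u B * fps_to_fls l2"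
      using A(1) unfolding rel_def by blast
    obtain G' where G': "\<And>s. tgen T 1 2 s *v x (Suc R) = fps_nth G' s *s \<xi>"
      "fps_to_fls G' = poly_in_u A' * fps_to_fls l1 - poly_in_u B' * fps_to_fls l2"
      using A'(1) unfolding rel_def by blast
    have "fps_nth G s *s \<xi> = fps_nth G' s *s \<xi>" for s using G(1) G'(1) by metis
    then have "G = G'" using \<xi> by (simp add: fps_eq_iff vec.scale_right_imp_eq)
    then show ?thesis using G(2) G'(2) by simp
  qed
  then have "poly_in_u (A' - A) * fps_to_fls l1 = poly_in_u (B' - B) * fps_to_fls l2"
    using leval_add[of "A' - A" A] leval_add[of "B' - B" B]
    by (simp add: poly_in_u_leval algebra_simps)
  moreover have "A' - A \<noteq> 0" using A(2) A'(2) by auto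
  ultimately show ?thesis by blast
qed

section \<open>Sums of small Weyl modules\<close>

lemma of_nat_neq_0_CHAR:
  assumes "0 < n" "n < CHAR('k::field)"
  shows "(of_nat n :: 'k) \<noteq> 0"
  using assms by (auto simp: of_nat_eq_0_iff_char_dvd dest: dvd_imp_le)

text \<open>On the basis f^k v the raising operator has coefficients k (N - k + 1), nonzero for 1
  \<le> k \<le> N < p. So its kernel is the highest weight line, which for N = 0 is the whole
  module.\<close>

lemma gl2_iso_weyl_kernel:
  fixes T :: "nat \<Rightarrow> nat \<Rightarrow> nat \<Rightarrow> 'k::field^'n^'n"
  assumes iso: "gl2_iso_weyl T W m1 m2"
    and N: "m1 - m2 = int N" "N + 1 < CHAR('k)"
    and x: "x \<in> W" "T 1 2 1 *v x = 0"
  shows "T 1 1 1 *v x - T 2 2 1 *v x = of_nat N *s x"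
    and "((*v) (T 2 1 1) ^^ Suc N) x = 0"
    and "x \<noteq> 0 \<Longrightarrow> ((*v) (T 2 1 1) ^^ N) x \<noteq> 0"
    and "N = 0 \<Longrightarrow> y \<in> W \<Longrightarrow> T 1 2 1 *v y = 0"
proof -
  obtain \<phi> :: "(nat \<Rightarrow> 'k) \<Rightarrow> 'k^'n" where bij: "bij_betw \<phi> (weyl_space m1 m2) W"
    and lin: "\<And>a c d. c \<in> weyl_space m1 m2 \<Longrightarrow> d \<in> weyl_space m1 m2 \<Longrightarrow>
       \<phi> (\<lambda>k. a * c k + d k) = a *s \<phi> c + \<phi> d"
    and act: "\<And>i j c. i \<in> {1,2} \<Longrightarrow> j \<in> {1,2} \<Longrightarrow> c \<in> weyl_space m1 m2 \<Longrightarrow>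
       \<phi> (weyl_act m1 m2 i j c) = T i j 1 *v \<phi> c"
    using iso unfolding gl2_iso_weyl_def by blast
  have zero_in: "(\<lambda>_. 0) \<in> weyl_space m1 m2" by (simp add: weyl_space_def)
  have \<phi>0: "\<phi> (\<lambda>_. 0) = 0"
    using lin[OF zero_in zero_in, of 1] by simp
  have scale: "\<phi> (\<lambda>k. a * c k) = a *s \<phi> c" if "c \<in> weyl_space m1 m2" for a c
    using lin[OF that zero_in, of a] \<phi>0 by simp
  have \<phi>_eq0: "c = (\<lambda>_. 0)" if "c \<in> weyl_space m1 m2" "\<phi> c = 0" for c
    by (rule inj_onD[OF bij_betw_imp_inj_on[OF bij] _ that(1) zero_in]) (simp add: that(2) \<phi>0)
  obtain c where c: "c \<in> weyl_space m1 m2" "x = \<phi> c"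
    using bij x(1) by (auto simp: bij_betw_def)
  have "\<phi> (weyl_act m1 m2 1 2 c) = 0"
    using act[of 1 2 c] c x(2) by simp
  moreover have "weyl_act m1 m2 1 2 c \<in> weyl_space m1 m2"
    by (simp add: weyl_space_def weyl_act_def)
  ultimately have e0: "weyl_act m1 m2 1 2 c = (\<lambda>_. 0)" by (rule \<phi>_eq0[rotated])
  have c_Suc: "c (Suc k) = 0" for k
  proof (cases "k < N")
    case True
    have "of_int ((int k + 1) * (m1 - m2 - int k)) * c (k + 1) = 0"
      using fun_cong[OF e0, of k] True N by (simp add: weyl_act_def)
    moreover have "(int k + 1) * (m1 - m2 - int k) = int (Suc k) * int (N - k)"
      using True N by simp
    ultimately have "of_int (int (Suc k) * int (N - k)) * c (Suc k) = 0"
      by (simp only: Suc_eq_plus1)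
    then have "of_nat (Suc k) * of_nat (N - k) * c (Suc k) = 0"
      by (simp only: of_int_mult of_int_of_nat_eq)
    moreover have "(of_nat (Suc k) :: 'k) \<noteq> 0" "(of_nat (N - k) :: 'k) \<noteq> 0"
      using True N by (intro of_nat_neq_0_CHAR; simp)+
    ultimately show ?thesis by simp
  next
    case False
    then show ?thesis using c(1) N by (simp add: weyl_space_def)
  qed
  \<comment> \<open>The coefficient sequence of f^i x, for i \<le> N.\<close>
  define v where "v i = (\<lambda>k. if k = i then c 0 else 0)" for i :: nat
  have v: "v i \<in> weyl_space m1 m2" if "i \<le> N" for i
    using that N by (simp add: v_def weyl_space_def)
  have cv: "c = v 0"
  proof
    show "c k = v 0 k" for k by (cases k) (simp_all add: v_def c_Suc)
  qed
  have f_v: "((*v) (T 2 1 1) ^^ i) x = \<phi> (v i)" if "i \<le> N" for i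
    using that
  proof (induction i)
    case 0
    then show ?case using c cv by simp
  next
    case (Suc i)
    have "weyl_act m1 m2 2 1 (v i) = v (Suc i)"
      using Suc.prems N by (auto simp: weyl_act_def v_def fun_eq_iff)
    then show ?case
      using Suc act[of 2 1 "v i"] v[of i] by simp
  qed
  have "weyl_act m1 m2 2 1 (v N) = (\<lambda>_. 0)"
    using N by (auto simp: weyl_act_def v_def fun_eq_iff)
  then show "((*v) (T 2 1 1) ^^ Suc N) x = 0"
    using f_v[of N] act[of 2 1 "v N"] v[of N] \<phi>0 by simp
  show "((*v) (T 2 1 1) ^^ N) x \<noteq> 0" if "x \<noteq> 0"
  proof
    assume "((*v) (T 2 1 1) ^^ N) x = 0"
    then have "v N = (\<lambda>_. 0)"
      using f_v[of N] v[of N] \<phi>_eq0 by simp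
    from fun_cong[OF this, of N] have "c 0 = 0" by (simp add: v_def)
    then have "c = (\<lambda>_. 0)" using c_Suc by (metis not0_implies_Suc)
    then show False using that c \<phi>0 by simp
  qed
  have "weyl_act m1 m2 1 1 c = (\<lambda>k. of_int m1 * c k)" "weyl_act m1 m2 2 2 c = (\<lambda>k. of_int m2 * c k)"
    using N unfolding cv by (auto simp: weyl_act_def v_def fun_eq_iff)
  then have "T 1 1 1 *v x = of_int m1 *s x" "T 2 2 1 *v x = of_int m2 *s x"
    using act[of 1 1 c] act[of 2 2 c] scale[of c] c by simp_all
  moreover have "of_int m1 - of_int m2 = (of_nat N :: 'k)"
    unfolding of_int_diff[symmetric] N(1) by simp
  ultimately show "T 1 1 1 *v x - T 2 2 1 *v x = of_nat N *s x"
    by (simp only: vec.scale_left_diff_distrib[symmetric])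
  show "T 1 2 1 *v y = 0" if h: "N = 0" "y \<in> W"
  proof -
    obtain d where d: "d \<in> weyl_space m1 m2" "y = \<phi> d"
      using bij h(2) by (auto simp: bij_betw_def)
    have "weyl_act m1 m2 1 2 d = (\<lambda>_. 0)"
      using h N by (auto simp: weyl_act_def fun_eq_iff)
    then show ?thesis using act[of 1 2 d] d \<phi>0 by simp
  qed
qed

text \<open>Uniqueness of the decomposition makes the projections \<open>pr j\<close> linear and
  equivariant, so vectors killed by the raising operator can be treated one Weyl module at a time by
  \<open>gl2_iso_weyl_kernel\<close>.\<close>

lemma gl2_weyl_decomp_components:
  fixes T :: "nat \<Rightarrow> nat \<Rightarrow> nat \<Rightarrow> 'k::field^'n^'n"
  assumes decomp: "gl2_weyl_decomp T m mu1 mu2"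
    and dom: "\<forall>j<m. mu1 j \<ge> mu2 j" and small: "\<forall>j<m. int CHAR('k) > mu1 j - mu2 j + 1"
  obtains pr :: "nat \<Rightarrow> 'k^'n \<Rightarrow> 'k^'n" and N :: "nat \<Rightarrow> nat" where
    "\<And>v. v = (\<Sum>j<m. pr j v)"
    "\<And>j i k v. j < m \<Longrightarrow> i \<in> {1,2} \<Longrightarrow> k \<in> {1,2} \<Longrightarrow> pr j (T i k 1 *v v) = T i k 1 *v pr j v"
    "\<And>j u v. j < m \<Longrightarrow> pr j (u - v) = pr j u - pr j v"
    "\<And>j a v. j < m \<Longrightarrow> pr j (a *s v) = a *s pr j v"
    "\<And>j. j < m \<Longrightarrow> N j + 1 < CHAR('k)"
    "\<And>j v. j < m \<Longrightarrow> T 1 2 1 *v pr j v = 0 \<Longrightarrow>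
       T 1 1 1 *v pr j v - T 2 2 1 *v pr j v = of_nat (N j) *s pr j v"
    "\<And>j v. j < m \<Longrightarrow> T 1 2 1 *v pr j v = 0 \<Longrightarrow> ((*v) (T 2 1 1) ^^ Suc (N j)) (pr j v) = 0"
    "\<And>j v. j < m \<Longrightarrow> T 1 2 1 *v pr j v = 0 \<Longrightarrow> pr j v \<noteq> 0 \<Longrightarrow>
       ((*v) (T 2 1 1) ^^ N j) (pr j v) \<noteq> 0"
    "\<And>j v. j < m \<Longrightarrow> N j = 0 \<Longrightarrow> T 1 2 1 *v pr j v = 0"
proof -
  obtain W :: "nat \<Rightarrow> ('k^'n) set" where W: "\<And>j. j < m \<Longrightarrow> vec.subspace (W j)"
    "\<And>j. j < m \<Longrightarrow> gl2_iso_weyl T (W j) (mu1 j) (mu2 j)"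
    and ex1: "\<And>v. \<exists>!w. (\<forall>j<m. w j \<in> W j) \<and> (\<forall>j\<ge>m. w j = 0) \<and> v = (\<Sum>j<m. w j)"
    using decomp unfolding gl2_weyl_decomp_def by blast
  define P where "P v w \<longleftrightarrow> (\<forall>j<m. w j \<in> W j) \<and> (\<forall>j\<ge>m. w j = 0) \<and> v = (\<Sum>j<m. w j)" for v w
  define pr where "pr j v = (THE w. P v w) j" for j v
  have P: "P v (\<lambda>j. pr j v)" for v
    using theI'[OF ex1[of v]] unfolding pr_def P_def by simp
  have uniq: "pr j v = w j" if "P v w" for v w j
    using ex1[of v] P[of v] that unfolding P_def[symmetric] by (metis (no_types))
  define N where "N j = nat (mu1 j - mu2 j)" for j
  have N: "mu1 j - mu2 j = int (N j)" "N j + 1 < CHAR('k)" if "j < m" for j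
    using dom small that by (force simp: N_def)+
  have pr_in: "pr j v \<in> W j" if "j < m" for j v using P that unfolding P_def by blast
  have pr_0: "pr j v = 0" if "j \<ge> m" for j v using P that unfolding P_def by blast
  have pr_sum: "(\<Sum>j<m. pr j v) = v" for v using P[of v] unfolding P_def by simp
  have inv: "T i k 1 *v w \<in> W j" if h: "j < m" "i \<in> {1,2}" "k \<in> {1,2}" "w \<in> W j" for i j k w
  proof -
    obtain \<phi> :: "(nat \<Rightarrow> 'k) \<Rightarrow> 'k^'n" where bij: "bij_betw \<phi> (weyl_space (mu1 j) (mu2 j)) (W j)"
      and act: "\<forall>i\<in>{1,2}. \<forall>k\<in>{1,2}. \<forall>c\<in>weyl_space (mu1 j) (mu2 j).
         \<phi> (weyl_act (mu1 j) (mu2 j) i k c) = T i k 1 *v \<phi> c"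
      using W(2)[OF h(1)] unfolding gl2_iso_weyl_def by blast
    obtain c where c: "c \<in> weyl_space (mu1 j) (mu2 j)" "w = \<phi> c"
      using bij h(4) by (auto simp: bij_betw_def)
    have "weyl_act (mu1 j) (mu2 j) i k c \<in> weyl_space (mu1 j) (mu2 j)"
      by (simp add: weyl_space_def weyl_act_def)
    moreover have "T i k 1 *v w = \<phi> (weyl_act (mu1 j) (mu2 j) i k c)"
      using act h c by metis
    ultimately show ?thesis using bij by (metis bij_betwE)
  qed
  show ?thesis
  proof (rule that[of pr N])
    show "v = (\<Sum>j<m. pr j v)" for v by (simp add: pr_sum)
    show "pr j (T i k 1 *v v) = T i k 1 *v pr j v" if "j < m" "i \<in> {1,2}" "k \<in> {1,2}" for i j k v
    proof (rule uniq)
      have "T i k 1 *v v = T i k 1 *v (\<Sum>j<m. pr j v)" by (simp only: pr_sum)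
      then show "P (T i k 1 *v v) (\<lambda>j. T i k 1 *v pr j v)"
        unfolding P_def using inv that pr_in by (auto simp: pr_0 vec.sum)
    qed
    show "pr j (u - v) = pr j u - pr j v" for j u v
      by (rule uniq[of _ "\<lambda>j. pr j u - pr j v"])
        (simp add: P_def pr_in pr_0 sum_subtractf pr_sum vec.subspace_diff W)
    show "pr j (a *s v) = a *s pr j v" for j a v
      by (rule uniq[of _ "\<lambda>j. a *s pr j v"])
        (simp add: P_def pr_in pr_0 vec.scale_sum_right[symmetric] pr_sum vec.subspace_scale W)
    show "N j + 1 < CHAR('k)" if "j < m" for j using N that by blast
    show "T 1 1 1 *v pr j v - T 2 2 1 *v pr j v = of_nat (N j) *s pr j v"
      if "j < m" "T 1 2 1 *v pr j v = 0" for j v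
      by (rule gl2_iso_weyl_kernel(1)[OF W(2)[OF that(1)] N[OF that(1)] pr_in[OF that(1)] that(2)])
    show "((*v) (T 2 1 1) ^^ Suc (N j)) (pr j v) = 0" if "j < m" "T 1 2 1 *v pr j v = 0" for j v
      by (rule gl2_iso_weyl_kernel(2)[OF W(2)[OF that(1)] N[OF that(1)] pr_in[OF that(1)] that(2)])
    show "((*v) (T 2 1 1) ^^ N j) (pr j v) \<noteq> 0"
      if "j < m" "T 1 2 1 *v pr j v = 0" "pr j v \<noteq> 0" for j v
      by (rule gl2_iso_weyl_kernel(3)[OF W(2)[OF that(1)] N[OF that(1)] pr_in[OF that(1)] that(2)]) (rule that(3))
    show "T 1 2 1 *v pr j v = 0" if "j < m" "N j = 0" for j v
    proof -
      have "0 \<in> W j" using W(1)[OF that(1)] by (rule vec.subspace_0)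
      then show ?thesis
        by (rule gl2_iso_weyl_kernel(4)[OF W(2)[OF that(1)] N[OF that(1)] _ _ that(2) pr_in[OF that(1)]]) simp
    qed
  qed
qed

context
  fixes T :: "nat \<Rightarrow> nat \<Rightarrow> nat \<Rightarrow> 'k::field^'n^'n" and m mu1 mu2
  assumes decomp: "gl2_weyl_decomp T m mu1 mu2"
    and dom: "\<forall>j<m. mu1 j \<ge> mu2 j" and small: "\<forall>j<m. int CHAR('k) > mu1 j - mu2 j + 1"
begin

text \<open>A nonzero component of v is a highest weight vector with N j + 2 congruent to n modulo
  p. As N j + 2 \<le> p and 0 < n < p, they are equal, and f^(n - 1) = f^(N j + 1) kills it.\<close>

lemma weyl_sum_lowering_nilpotent:
  assumes v: "T 1 2 1 *v v = 0" "T 1 1 1 *v v - T 2 2 1 *v v = (of_nat n - 2) *s v"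
    and n: "0 < n" "n + 1 < CHAR('k)"
  shows "((*v) (T 2 1 1) ^^ (n - 1)) v = 0"
proof -
  from decomp dom small show ?thesis
  proof (rule gl2_weyl_decomp_components, goal_cases)
    case (1 pr N)
    note pr = 1
    have "((*v) (T 2 1 1) ^^ (n - 1)) (pr j v) = 0" if j: "j < m" for j
    proof (cases "pr j v = 0")
      case True
      have "((*v) (T 2 1 1) ^^ i) 0 = 0" for i by (induction i) simp_all
      then show ?thesis by (simp add: True)
    next
      case False
      have pr0: "pr j 0 = 0" using pr(3)[OF j, of 0 0] by simp
      have E: "T 1 2 1 *v pr j v = 0" using pr(2)[OF j, of 1 2 v] v(1) pr0 by simp
      have "T 1 1 1 *v pr j v - T 2 2 1 *v pr j v = pr j (T 1 1 1 *v v - T 2 2 1 *v v)"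
        using pr(2)[OF j, of 1 1 v] pr(2)[OF j, of 2 2 v] by (simp add: pr(3)[OF j])
      also have "\<dots> = (of_nat n - 2) *s pr j v"
        unfolding v(2) by (rule pr(4)[OF j])
      finally have "of_nat (N j) *s pr j v = (of_nat n - 2) *s pr j v"
        using pr(6)[OF j E] by simp
      then have "of_nat (N j) = (of_nat n - 2 :: 'k)"
        using False by (metis vec.scale_right_imp_eq vec.scale_cancel_right)
      then have "of_nat (N j + 2) = (of_nat n :: 'k)" by simp
      then have "[N j + 2 = n] (mod CHAR('k))"
        by (simp only: of_nat_eq_iff_cong_CHAR)
      then have "N j + 2 = n"
        using pr(5)[OF j] n by (cases "N j + 2 = CHAR('k)") (auto simp: cong_def)
      then show ?thesis using pr(7)[OF j E] by auto
    qed
    moreover have "((*v) (T 2 1 1) ^^ i) (\<Sum>j<m. pr j v) = (\<Sum>j<m. ((*v) (T 2 1 1) ^^ i) (pr j v))" for i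
      by (induction i) (simp_all add: vec.sum)
    ultimately show ?thesis using pr(1)[of v] by (metis (no_types, lifting) lessThan_iff sum.neutral)
  qed
qed

text \<open>A nonzero component of v is a highest weight vector of weight \<kappa>, so n can be
  taken from its Weyl module; its nonzero image under f^n is a projection of f^n v.\<close>

lemma weyl_sum_highest_weight:
  assumes v: "v \<noteq> 0" "T 1 2 1 *v v = 0" "T 1 1 1 *v v - T 2 2 1 *v v = \<kappa> *s v"
  shows "\<exists>n. n + 1 < CHAR('k) \<and> \<kappa> = of_nat n \<and> ((*v) (T 2 1 1) ^^ n) v \<noteq> 0"
proof -
  from decomp dom small show ?thesis
  proof (rule gl2_weyl_decomp_components, goal_cases)
    case (1 pr N)
    note pr = 1
    obtain j where j: "j < m" "pr j v \<noteq> 0"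
      using v(1) pr(1)[of v] by (metis lessThan_iff sum.neutral)
    have pr0: "pr j 0 = 0" using pr(3)[OF j(1), of 0 0] by simp
    have E: "T 1 2 1 *v pr j v = 0" using pr(2)[OF j(1), of 1 2 v] v(2) pr0 by simp
    have "T 1 1 1 *v pr j v - T 2 2 1 *v pr j v = pr j (T 1 1 1 *v v - T 2 2 1 *v v)"
      using pr(2)[OF j(1), of 1 1 v] pr(2)[OF j(1), of 2 2 v] by (simp add: pr(3)[OF j(1)])
    also have "\<dots> = \<kappa> *s pr j v"
      unfolding v(3) by (rule pr(4)[OF j(1)])
    finally have "of_nat (N j) = \<kappa>"
      using pr(6)[OF j(1) E] j(2) by (metis vec.scale_cancel_right)
    moreover have "pr j (((*v) (T 2 1 1) ^^ i) v) = ((*v) (T 2 1 1) ^^ i) (pr j v)" for i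
      using pr(2)[OF j(1), of 2 1] by (induction i) simp_all
    then have "((*v) (T 2 1 1) ^^ N j) v \<noteq> 0"
      using pr(8)[OF j(1) E j(2)] pr0 by metis
    ultimately show ?thesis using pr(5)[OF j(1)] by blast
  qed
qed

text \<open>A nonzero component of the raised vector would have weight 0, which by N j < p forces a
  one-dimensional Weyl module; but there the raising operator is zero.\<close>

lemma weyl_sum_trivial_weight:
  assumes v: "T 1 2 1 *v (T 1 2 1 *v v) = 0"
    "T 1 1 1 *v (T 1 2 1 *v v) - T 2 2 1 *v (T 1 2 1 *v v) = 0"
  shows "T 1 2 1 *v v = 0"
proof -
  from decomp dom small show ?thesis
  proof (rule gl2_weyl_decomp_components, goal_cases)
    case (1 pr N)
    note pr = 1
    have "pr j (T 1 2 1 *v v) = 0" if j: "j < m" for j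
    proof (rule ccontr)
      assume neq: "pr j (T 1 2 1 *v v) \<noteq> 0"
      let ?v = "T 1 2 1 *v v"
      have pr0: "pr j 0 = 0" using pr(3)[OF j, of 0 0] by simp
      have E: "T 1 2 1 *v pr j ?v = 0" using pr(2)[OF j, of 1 2 ?v] v(1) pr0 by simp
      have "T 1 1 1 *v pr j ?v - T 2 2 1 *v pr j ?v = pr j (T 1 1 1 *v ?v - T 2 2 1 *v ?v)"
        using pr(2)[OF j, of 1 1 ?v] pr(2)[OF j, of 2 2 ?v] by (simp add: pr(3)[OF j])
      then have "of_nat (N j) *s pr j ?v = 0"
        using pr(6)[OF j E] v(2) pr0 by simp
      then have "of_nat (N j) = (0 :: 'k)" using neq by simp
      then have "N j = 0"
        using pr(5)[OF j] of_nat_neq_0_CHAR[of "N j", where 'k='k] by (cases "N j = 0") auto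
      then have "T 1 2 1 *v pr j v = 0" by (rule pr(9)[OF j])
      then show False using neq pr(2)[OF j, of 1 2 v] by simp
    qed
    then show ?thesis using pr(1)[of "T 1 2 1 *v v"] by (metis lessThan_iff sum.neutral)
  qed
qed

end

section \<open>The highest weight under the Weyl module hypothesis\<close>

text \<open>Over a finite field, 1 plus the product of all x - a has no root.\<close>

lemma infinite_UNIV_if_roots:
  assumes "\<forall>P :: 'k::field poly. degree P \<ge> 1 \<longrightarrow> (\<exists>x. poly P x = 0)"
  shows "infinite (UNIV :: 'k set)"
proof
  assume fin: "finite (UNIV :: 'k set)"
  define P where "P = (\<Prod>a\<in>(UNIV :: 'k set). [:- a, 1:])"
  have "degree P = card (UNIV :: 'k set)"
    by (simp add: P_def degree_prod_eq_sum_degree)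
  then have "degree (P + 1) \<ge> 1"
    using fin by (simp add: degree_add_eq_left card_gt_0_iff Suc_le_eq)
  then obtain x where "poly (P + 1) x = 0" using assms by blast
  moreover have "poly P x = 0"
    using fin by (auto simp: P_def poly_prod)
  ultimately show False by simp
qed

text \<open>The defining relation at r = 0, where t_ij^(0) is scalar: t_kl^(s) transforms under gl_2
  like E_kl.\<close>

lemma gl2_adjoint_action:
  assumes T: "yangian_rep T" and ij: "i \<in> {1,2}" "j \<in> {1,2}" "k \<in> {1,2}" "l \<in> {1,2}"
  shows "T i j 1 *v (tgen T k l s *v v) = tgen T k l s *v (T i j 1 *v v)
    + (if k = j then tgen T i l s *v v else 0) - (if i = l then tgen T k j s *v v else 0)"
proof -
  have "comm (tgen T i j 0) (tgen T k l (Suc s)) = 0"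
    by (simp add: comm_def tgen_def mat_alg)
  then have "comm (T i j 1) (tgen T k l s) = tgen T k j 0 ** tgen T i l s - tgen T k j s ** tgen T i l 0"
    using yangian_rel[OF T ij, of 0 s] by (simp add: tgen_def)
  then have "comm (T i j 1) (tgen T k l s) *v v
    = (tgen T k j 0 ** tgen T i l s - tgen T k j s ** tgen T i l 0) *v v" by simp
  then show ?thesis
    by (simp add: comm_def matrix_vector_mult_diff_rdistrib matrix_vector_mul_assoc[symmetric]
        algebra_simps del: One_nat_def) (auto simp: tgen_def algebra_simps vec.zero)
qed

text \<open>f commutes with t_21^(s), and [t_11^(s), f] = - t_21^(s), so each factor f contributes
  one copy of t_21^(s).\<close>

lemma lowering_commutation:
  assumes T: "yangian_rep T"
  shows "tgen T 2 1 s *v (((*v) (T 2 1 1) ^^ m) v) = ((*v) (T 2 1 1) ^^ m) (tgen T 2 1 s *v v)"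
    and "tgen T 1 1 s *v (((*v) (T 2 1 1) ^^ Suc m) v)
      = ((*v) (T 2 1 1) ^^ Suc m) (tgen T 1 1 s *v v)
        - of_nat (Suc m) *s ((*v) (T 2 1 1) ^^ m) (tgen T 2 1 s *v v)"
proof -
  have c21: "T 2 1 1 *v (tgen T 2 1 s *v w) = tgen T 2 1 s *v (T 2 1 1 *v w)" for w
    using gl2_adjoint_action[OF T, of 2 1 2 1 s w] by simp
  have c11: "tgen T 1 1 s *v (T 2 1 1 *v w) = T 2 1 1 *v (tgen T 1 1 s *v w) - tgen T 2 1 s *v w" for w
    using gl2_adjoint_action[OF T, of 2 1 1 1 s w] by simp
  show t21: "tgen T 2 1 s *v (((*v) (T 2 1 1) ^^ m) v) = ((*v) (T 2 1 1) ^^ m) (tgen T 2 1 s *v v)" for m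
    by (induction m) (simp_all add: c21[symmetric] del: One_nat_def)
  show "tgen T 1 1 s *v (((*v) (T 2 1 1) ^^ Suc m) v)
      = ((*v) (T 2 1 1) ^^ Suc m) (tgen T 1 1 s *v v)
        - of_nat (Suc m) *s ((*v) (T 2 1 1) ^^ m) (tgen T 2 1 s *v v)"
  proof (induction m)
    case 0
    show ?case using c11[of v] by (simp del: One_nat_def)
  next
    case (Suc m)
    let ?F = "(*v) (T 2 1 1)"
    have "tgen T 1 1 s *v ((?F ^^ Suc (Suc m)) v)
      = T 2 1 1 *v (tgen T 1 1 s *v (?F ^^ Suc m) v) - (?F ^^ Suc m) (tgen T 2 1 s *v v)"
      using c11[of "(?F ^^ Suc m) v"] t21[of "Suc m"] by (simp del: One_nat_def)
    also have "T 2 1 1 *v (tgen T 1 1 s *v (?F ^^ Suc m) v)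
      = (?F ^^ Suc (Suc m)) (tgen T 1 1 s *v v) - of_nat (Suc m) *s (?F ^^ Suc m) (tgen T 2 1 s *v v)"
      unfolding Suc by (simp add: vec.diff vec.scale del: One_nat_def of_nat_Suc)
    finally show ?case by (simp add: vec_eq_iff algebra_simps del: One_nat_def)
  qed
qed

section \<open>Eigenvalues of the central product\<close>

definition cvec :: "'k::field^'n \<Rightarrow> 'k fps^'n" where
  "cvec v = (\<chi> i. fps_const (v $ i))"

lemma cvec_nth [simp]: "cvec v $ i = fps_const (v $ i)"
  by (simp add: cvec_def)

lemma cvec_mult: "cvec (A *v v) = cmat A *v cvec v"
  by (simp add: vec_eq_iff matrix_vector_mult_def fps_eq_iff fps_sum_nth)

lemma tval_eigenvector:
  assumes b: "fps_nth b 0 = 0" and v: "\<And>r. tgen T i j r *v v = fps_nth l r *s v"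
  shows "tval T i j b *v cvec v = (l oo b) *s cvec v"
proof -
  have "(\<Sum>\<beta>\<in>UNIV. Abs_fps (\<lambda>r. tgen T i j r $ \<alpha> $ \<beta>) * fps_const (v $ \<beta>)) = l * fps_const (v $ \<alpha>)" for \<alpha>
  proof (rule fps_ext)
    fix r
    show "fps_nth (\<Sum>\<beta>\<in>UNIV. Abs_fps (\<lambda>r. tgen T i j r $ \<alpha> $ \<beta>) * fps_const (v $ \<beta>)) r
      = fps_nth (l * fps_const (v $ \<alpha>)) r"
      using arg_cong[OF v[of r], where f = "\<lambda>x. x $ \<alpha>"]
      by (simp add: fps_sum_nth matrix_vector_mult_def)
  qed
  from arg_cong[OF this, where f = "\<lambda>F. F oo b"] show ?thesis
    by (simp add: vec_eq_iff matrix_vector_mult_def tval_def fps_compose_sum_distrib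
      fps_compose_mult_distrib b)
qed

lemma shift_prod_eigenvector:
  fixes T :: "nat \<Rightarrow> nat \<Rightarrow> nat \<Rightarrow> 'k::field^'n^'n"
  assumes v: "\<And>r. tgen T 1 1 r *v v = fps_nth l r *s v"
  shows "shift_prod T 0 k *v cvec v = (\<Prod>j<k. l oo shiftser j) *s cvec v"
proof -
  have "shift_prod T i k *v cvec v = (\<Prod>j\<in>{i..<i + k}. l oo shiftser j) *s cvec v" for i
  proof (induction k arbitrary: i)
    case (Suc k)
    have "shift_prod T i (Suc k) *v cvec v = tval T 1 1 (shiftser i) *v (shift_prod T (Suc i) k *v cvec v)"
      by (simp add: matrix_vector_mul_assoc)
    also have "\<dots> = (\<Prod>j\<in>{Suc i..<Suc i + k}. l oo shiftser j) *s (tval T 1 1 (shiftser i) *v cvec v)"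
      unfolding Suc by (simp add: vec_eq_iff matrix_vector_mult_def sum_distrib_left mult_ac)
    also have "tval T 1 1 (shiftser i) *v cvec v = (l oo shiftser i) *s cvec v"
      by (rule tval_eigenvector[OF shiftser_nth_0 v])
    also have "(\<Prod>j\<in>{Suc i..<Suc i + k}. l oo shiftser j) *s ((l oo shiftser i) *s cvec v)
       = (\<Prod>j\<in>{i..<i + Suc k}. l oo shiftser j) *s cvec v"
    proof -
      have "(\<Prod>j\<in>{i..<i + Suc k}. l oo shiftser j) = (l oo shiftser i) * (\<Prod>j\<in>{Suc i..<Suc i + k}. l oo shiftser j)"
        by (subst prod.atLeast_Suc_lessThan) simp_all
      then show ?thesis by (simp only: vector_smult_assoc mult.commute)
    qed
    finally show ?case .
  qed simp
  from this[of 0] show ?thesis by (simp add: atLeast0LessThan)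
qed

text \<open>Schur's lemma for an operator with power series entries: the constant vectors on which B
  acts by the series b form a submodule, nonzero because of v.\<close>

lemma central_scalar:
  fixes T :: "nat \<Rightarrow> nat \<Rightarrow> nat \<Rightarrow> 'k::field^'n^'n"
  assumes irr: "yirreducible T"
    and central: "\<And>(i :: nat) (j :: nat) s. i \<in> {1,2} \<Longrightarrow> j \<in> {1,2} \<Longrightarrow> B ** cmat (tgen T i j s) = cmat (tgen T i j s) ** B"
    and v: "v \<noteq> 0" "B *v cvec v = b *s cvec v"
  shows "B *v cvec w = b *s cvec w"
proof -
  define S where "S = {w :: 'k^'n. B *v cvec w = b *s cvec w}"
  have "vec.subspace S"
  proof (rule vec.subspaceI)
    show "0 \<in> S" by (simp add: S_def vec_eq_iff matrix_vector_mult_def)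
    show "x + y \<in> S" if "x \<in> S" "y \<in> S" for x y
      using that by (simp add: S_def vec_eq_iff matrix_vector_mult_def fps_const_add[symmetric]
        distrib_left sum.distrib del: fps_const_add)
    show "c *s x \<in> S" if "x \<in> S" for c x
      using that by (simp add: S_def vec_eq_iff matrix_vector_mult_def fps_const_mult[symmetric]
        mult.left_commute[of _ "fps_const c"] sum_distrib_left[symmetric] del: fps_const_mult)
  qed
  moreover have "yinvariant T S"
    unfolding yinvariant_def
  proof (intro ballI allI impI)
    fix i j r :: nat and w assume ij: "i \<in> {1,2}" "j \<in> {1,2}" and r: "1 \<le> r" and w: "w \<in> S"
    have t: "tgen T i j r = T i j r" using r by (simp add: tgen_def)
    have "B *v cvec (T i j r *v w) = cmat (T i j r) *v (B *v cvec w)"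
      using central[OF ij, of r] by (simp add: cvec_mult matrix_vector_mul_assoc t)
    also have "\<dots> = b *s cvec (T i j r *v w)"
      using w by (simp add: S_def cvec_mult)
        (simp add: vec_eq_iff matrix_vector_mult_def sum_distrib_left mult_ac)
    finally show "T i j r *v w \<in> S" by (simp add: S_def)
  qed
  ultimately have "S = {0} \<or> S = UNIV" using irr unfolding yirreducible_def by blast
  then have "S = UNIV" using v by (auto simp: S_def)
  then show ?thesis by (auto simp: S_def)
qed

theorem theorem3p2p4:
  fixes p :: nat and T :: "nat \<Rightarrow> nat \<Rightarrow> nat \<Rightarrow> 'k::field^'n^'n"
    and m :: nat and mu1 mu2 :: "nat \<Rightarrow> int" and lam :: "nat \<Rightarrow> nat \<Rightarrow> 'k"
  assumes "prime p"
    and "is_alg_closure_Fp p TYPE('k)"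
    and "yangian_rep T"
    and "gl2_weyl_decomp T m mu1 mu2"
    and "\<forall>j<m. mu1 j \<ge> mu2 j"
    and "\<forall>j<m. int p > mu1 j - mu2 j + 1"
    and "iso_L_lambda T lam"
  shows "\<exists>P :: 'k poly. lead_coeff P = 1 \<and>
           lam_series lam 1 / lam_series lam 2
             = poly_in_u (P \<circ>\<^sub>p [:1, 1:]) / poly_in_u P"
proof -
  note T = assms(3)
  have p: "CHAR('k) = p" "p > 0" and inf: "infinite (UNIV :: 'k set)"
    using assms(1,2) infinite_UNIV_if_roots prime_gt_0_nat unfolding is_alg_closure_Fp_def by blast+
  have p0: "of_nat p = (0 :: 'k)" using p(1) of_nat_CHAR by blast
  note weyl = assms(4,5) assms(6)[folded p(1)]
  obtain \<xi> where irr: "yirreducible T" and \<xi>: "\<xi> \<noteq> 0" "\<forall>r\<ge>1. T 1 2 r *v \<xi> = 0"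
    "\<forall>i\<in>{1,2}. \<forall>r\<ge>1. T i i r *v \<xi> = lam i r *s \<xi>"
    using assms(7) unfolding iso_L_lambda_def by blast
  define l where "l i = Abs_fps (\<lambda>r. if r = 0 then 1 else lam i r)" for i
  have t12: "tgen T 1 2 r *v \<xi> = 0" for r using \<xi>(2) by (simp add: tgen_def)
  have tii: "tgen T i i r *v \<xi> = fps_nth (l i) r *s \<xi>" if "i \<in> {1,2}" for i r
    using \<xi>(3) that by (auto simp: tgen_def l_def)
  have t11: "tgen T 1 1 r *v \<xi> = fps_nth (l 1) r *s \<xi>" and t22: "tgen T 2 2 r *v \<xi> = fps_nth (l 2) r *s \<xi>" for r
    using tii by blast+
  have E\<xi>: "T 1 2 1 *v \<xi> = 0" using \<xi>(2) by simp
  have H\<xi>: "T 1 1 1 *v \<xi> - T 2 2 1 *v \<xi> = (lam 1 1 - lam 2 1) *s \<xi>"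
    using \<xi>(3) by (simp add: vec.scale_left_diff_distrib)
  obtain n where n: "n + 1 < p" "lam 1 1 - lam 2 1 = of_nat n" "((*v) (T 2 1 1) ^^ n) \<xi> \<noteq> 0"
    using weyl_sum_highest_weight[OF weyl \<xi>(1) E\<xi> H\<xi>] p(1) by blast
  define y where "y r = tgen T 2 1 r *v \<xi>" for r
  define \<delta> where "\<delta> r = fps_nth (l 1) r - fps_nth (l 2) r" for r
  have Ey: "T 1 2 1 *v y r = \<delta> r *s \<xi>" for r
    using gl2_adjoint_action[OF T, of 1 2 2 1 r \<xi>] E\<xi> t11[of r] t22[of r]
    by (simp add: y_def \<delta>_def vec.zero vec.scale_left_diff_distrib)
  have "\<exists>P. lead_coeff P = 1 \<and>
    fps_to_fls (l 1) / fps_to_fls (l 2) = poly_in_u (P \<circ>\<^sub>p [:1, 1:]) / poly_in_u P"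
  proof (cases "n = 0")
    case True
    \<comment> \<open>Here p may be 2, while \<open>shift_prod_central\<close> needs 2 \<noteq> 0.
      Instead, \<delta> r \<xi> is the raised y r and has sl_2-weight 0.\<close>
    have "\<delta> r *s \<xi> = 0" for r
    proof -
      have "T 1 2 1 *v (T 1 2 1 *v y r) = 0"
        unfolding Ey by (simp add: vec.scale E\<xi> del: One_nat_def)
      moreover have "T 1 1 1 *v (T 1 2 1 *v y r) - T 2 2 1 *v (T 1 2 1 *v y r)
          = \<delta> r *s (T 1 1 1 *v \<xi> - T 2 2 1 *v \<xi>)"
        unfolding Ey by (simp add: vec.scale vec.scale_right_diff_distrib del: One_nat_def)
      then have "T 1 1 1 *v (T 1 2 1 *v y r) - T 2 2 1 *v (T 1 2 1 *v y r) = 0"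
        using H\<xi> n(2) True by simp
      ultimately have "T 1 2 1 *v y r = 0"
        by (rule weyl_sum_trivial_weight[OF weyl])
      then show ?thesis using Ey[of r] by simp
    qed
    then have "\<delta> r = 0" for r using \<xi>(1) by simp
    then have "l 1 = l 2" by (simp add: \<delta>_def fps_eq_iff)
    moreover have "fps_nth (l 2) 0 = 1" by (simp add: l_def)
    then have "l 2 \<noteq> 0" by auto
    ultimately show ?thesis
      by (intro exI[of _ 1]) (simp add: pcompose_1)
  next
    case False
    define \<eta> where "\<eta> = ((*v) (T 2 1 1) ^^ n) \<xi>"
    have n_neq: "of_nat n \<noteq> (0 :: 'k)"
      using of_nat_neq_0_CHAR[of n, where 'k='k] False n(1) p(1) by simp
    \<comment> \<open>n > 0 and n + 1 < p force p > 2.\<close>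
    have two: "(2 :: 'k) \<noteq> 0"
      using of_nat_neq_0_CHAR[of 2, where 'k='k] False n(1) p(1) by simp
    have F\<xi>: "T 2 1 1 *v \<xi> = y 1" by (simp add: y_def tgen_def)
    have "tgen T 1 1 r *v \<eta> = fps_nth (l 2) r *s \<eta>" for r
    proof -
      \<comment> \<open>Since \<delta> 1 = n, this multiple of y 1 makes the raising operator kill
        z, which has weight n - 2.\<close>
      define z where "z = y r - (\<delta> r / of_nat n) *s y 1"
      have \<delta>1: "\<delta> 1 = of_nat n" using n(2) by (simp add: \<delta>_def l_def)
      have Ez: "T 1 2 1 *v z = 0"
        unfolding z_def vec.diff vec.scale Ey \<delta>1 using n_neq by simp
      have H: "T 1 1 1 *v y s - T 2 2 1 *v y s = (of_nat n - 2) *s y s" for s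
      proof -
        have "T 1 1 1 *v y s - T 2 2 1 *v y s
          = tgen T 2 1 s *v (T 1 1 1 *v \<xi> - T 2 2 1 *v \<xi>) - 2 *s y s"
          using gl2_adjoint_action[OF T, of 1 1 2 1 s \<xi>] gl2_adjoint_action[OF T, of 2 2 2 1 s \<xi>]
          by (simp add: y_def vec.diff del: One_nat_def) (simp add: vec_eq_iff)
        then show ?thesis
          unfolding H\<xi> n(2) vec.scale y_def[symmetric] by (simp add: vec.scale_left_diff_distrib)
      qed
      have "T 1 1 1 *v z - T 2 2 1 *v z
        = (T 1 1 1 *v y r - T 2 2 1 *v y r) - (\<delta> r / of_nat n) *s (T 1 1 1 *v y 1 - T 2 2 1 *v y 1)"
        by (simp add: z_def vec.diff vec.scale vec.scale_right_diff_distrib del: One_nat_def)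
      also have "\<dots> = (of_nat n - 2) *s z"
        unfolding H z_def by (simp add: vec_eq_iff algebra_simps)
      finally have "((*v) (T 2 1 1) ^^ (n - 1)) z = 0"
        using weyl_sum_lowering_nilpotent[OF weyl Ez] False n(1) p(1) by simp
      moreover have "((*v) (T 2 1 1) ^^ i) z = ((*v) (T 2 1 1) ^^ i) (y r)
          - (\<delta> r / of_nat n) *s ((*v) (T 2 1 1) ^^ i) (y 1)" for i
        by (induction i) (simp_all add: z_def vec.diff vec.scale del: One_nat_def)
      moreover have "((*v) (T 2 1 1) ^^ (n - 1)) (y 1) = \<eta>"
      proof -
        have "((*v) (T 2 1 1) ^^ Suc (n - 1)) \<xi> = ((*v) (T 2 1 1) ^^ (n - 1)) (T 2 1 1 *v \<xi>)"
          by (simp only: funpow_Suc_right o_apply)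
        then show ?thesis using False by (simp add: \<eta>_def F\<xi> del: One_nat_def funpow.simps)
      qed
      ultimately have y\<eta>: "((*v) (T 2 1 1) ^^ (n - 1)) (y r) = (\<delta> r / of_nat n) *s \<eta>"
        by simp
      have scale: "((*v) (T 2 1 1) ^^ i) (c *s v) = c *s ((*v) (T 2 1 1) ^^ i) v" for i c v
        by (induction i) (simp_all add: vec.scale del: One_nat_def)
      \<comment> \<open>The n copies of f^(n - 1) y r add up to \<delta> r \<eta>, which turns the
        coefficient of \<lambda>_1 into that of \<lambda>_2.\<close>
      have "tgen T 1 1 r *v \<eta> = fps_nth (l 1) r *s \<eta> - of_nat n *s ((\<delta> r / of_nat n) *s \<eta>)"
        using lowering_commutation(2)[OF T, of r "n - 1" \<xi>] False
        unfolding y_def[symmetric] y\<eta> t11 scale by (simp add: \<eta>_def del: One_nat_def funpow.simps)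
      also have "\<dots> = fps_nth (l 2) r *s \<eta>"
        using n_neq by (simp add: \<delta>_def vec.scale_left_diff_distrib)
      finally show ?thesis .
    qed
    then have "shift_prod T 0 p *v cvec \<eta> = (\<Prod>j<p. l 2 oo shiftser j) *s cvec \<eta>"
      by (rule shift_prod_eigenvector)
    \<comment> \<open>The scalar of the central B(u), read off at \<xi>, applies at \<eta> as
      well.\<close>
    moreover have "shift_prod T 0 p *v cvec \<eta> = (\<Prod>j<p. l 1 oo shiftser j) *s cvec \<eta>"
      by (rule central_scalar[OF irr shift_prod_central[OF T p0 two inf] \<xi>(1)
        shift_prod_eigenvector[OF t11]])
    ultimately have "(\<Prod>j<p. l 1 oo shiftser j) *s cvec \<eta> = (\<Prod>j<p. l 2 oo shiftser j) *s cvec \<eta>"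
      by simp
    moreover obtain i where "\<eta> $ i \<noteq> 0"
      using n(3) unfolding \<eta>_def[symmetric] by (auto simp: vec_eq_iff)
    ultimately have norm: "(\<Prod>j<p. l 1 oo shiftser j) = (\<Prod>j<p. l 2 oo shiftser j)"
      by (auto simp: vec_eq_iff dest: spec[of _ i])
    have l0: "fps_nth (l i) 0 = 1" for i by (simp add: l_def)
    obtain A B where "A \<noteq> 0" "poly_in_u A * fps_to_fls (l 1) = poly_in_u B * fps_to_fls (l 2)"
      using highest_weight_rational[OF T \<xi>(1) t12 t11 t22 l0] by blast
    then show ?thesis
      using quotient_of_equal_shift_products[OF p _ l0 l0 _ norm] by blast
  qed
  then show ?thesis by (simp add: lam_series_def l_def)
qed

end
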